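(* Let $G\subset GL(d,\mathbb C)$ be a reductive algebraic matrix group and let $H\subset G$ be a cyclic group of order $m$ consisting of scalar matrices. Let $F_N$ be the free group on $\gamma_1,\dots,\gamma_N$, and let $\psi: X_G(F_N)\to X_{G/H}(F_N)$ be the map induced by the projection $G\to G/H$. (1) If $g_1,\dots,g_k\in F_N$ satisfy $\sum_{i=1}^k v(g_i)=0$ in $(\mathbb Z/m)^N$, then there exists a unique function $\lambda_{g_1,\dots,g_k}\in\mathbb C[X_{G/H}(F_N)]$ such that $\tau_{g_1}\cdots\tau_{g_k}=\lambda_{g_1,\dots,g_k}\circ\psi$. (2) Suppose that $\mathbb C[X_G(F_N)]$ is generated (as a $\mathbb C$-algebra) by the functions $\tau_g$ for $g$ in a set $B\subset F_N$. Let $\mathcal M$ be the set of all $\lambda_{g_1,\dots,g_k}$ for $k\ge1$ and $g_1,\dots,g_k\in B$ such that $\sum_{i=1}^k v(g_i)=0$. Then $\mathbb C[X_{G/H}(F_N)]$ is generated as a $\mathbb C$-algebra by $\mathcal M$.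
   Context: For an affine reductive algebraic group $G$ over $\mathbb C$, $Hom(F_N,G)=G^N$, $G$ acts on it by simultaneous conjugation, and $X_G(F_N)=G^N//G$ is the categorical quotient, so $\mathbb C[X_G(F_N)]=\mathbb C[G^N]^G$. For $g\in F_N$, $\tau_g\in\mathbb C[X_G(F_N)]$ is $\tau_g([\rho])=\mathrm{tr}(\rho(g))$ (trace of $d\times d$ matrices). For $\gamma\in F_N$, $v(\gamma)\in(\mathbb Z/m)^N$ is the vector whose $i$-th component is the sum (mod $m$) of the exponents of $\gamma_i$ in $\gamma$. *)

theory Defs
  imports "HOL-Analysis.Analysis" "HOL-Algebra.Elementary_Groups"
begin

section \<open>The free group\<close>

text \<open>The letter \<open>(i, True)\<close> stands for the generator \<open>\<gamma>\<^sub>i\<close> and \<open>(i, False)\<close> for its inverse.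
  Elements of the free group are the reduced words.\<close>

type_synonym 'n word = "('n \<times> bool) list"

definition inv_letter :: "'n \<times> bool \<Rightarrow> 'n \<times> bool" where
  "inv_letter x = (fst x, \<not> snd x)"

fun cons_reduce :: "'n \<times> bool \<Rightarrow> 'n word \<Rightarrow> 'n word" where
  "cons_reduce x [] = [x]"
| "cons_reduce x (y # w) = (if y = inv_letter x then w else x # y # w)"

definition reduce :: "'n word \<Rightarrow> 'n word" where
  "reduce w = foldr cons_reduce w []"

definition free_group :: "'n word monoid" where
  "free_group = \<lparr>carrier = {w. reduce w = w}, mult = (\<lambda>u v. reduce (u @ v)), one = []\<rparr>"

definition exponent_vector :: "nat \<Rightarrow> 'n word \<Rightarrow> 'n \<Rightarrow> int" where
  "exponent_vector m g i =
     (\<Sum>(j, b)\<leftarrow>g. if j = i then (if b then 1 else - 1) else 0) mod int m"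

lemma inv_letter_inv_letter [simp]: "inv_letter (inv_letter x) = x"
  by (simp add: inv_letter_def)

lemma inv_letter_neq [simp]: "inv_letter x \<noteq> x" "x \<noteq> inv_letter x"
  by (auto simp: inv_letter_def prod_eq_iff)

lemma reduce_Nil [simp]: "reduce [] = []"
  by (simp add: reduce_def)

lemma reduce_Cons [simp]: "reduce (x # w) = cons_reduce x (reduce w)"
  by (simp add: reduce_def)

lemma reduced_ConsD:
  assumes "reduce (x # w) = x # w"
  shows "reduce w = w"
proof (cases "reduce w")
  case Nil
  with assms show ?thesis by simp
next
  case (Cons y u)
  have "length (reduce v) \<le> length v" for v :: "'a word"
  proof (induction v)
    case (Cons z v)
    then show ?case by (cases "reduce v") auto
  qed simp
  from this[of w] Cons assms show ?thesis by (auto split: if_splits)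
qed

lemma cons_reduce_cancel:
  assumes "reduce w = w"
  shows "cons_reduce x (cons_reduce (inv_letter x) w) = w"
proof (cases w)
  case (Cons y u)
  show ?thesis
  proof (cases "y = x")
    case True
    have "reduce u = u" using assms Cons reduced_ConsD by blast
    with True Cons assms show ?thesis by simp
  qed (use Cons in auto)
qed simp

lemma reduce_reduce [simp]: "reduce (reduce w) = reduce w"
proof (induction w)
  case (Cons x w)
  then show ?case
  proof (cases "reduce w")
    case (Cons y u)
    then show ?thesis using Cons.IH reduced_ConsD[of y u] by auto
  qed simp
qed simp

lemma reduce_append: "reduce (u @ v) = foldr cons_reduce u (reduce v)"
  by (simp add: reduce_def)

lemma reduced_foldr: "reduce v = v \<Longrightarrow> reduce (foldr cons_reduce u v) = foldr cons_reduce u v"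
  by (metis reduce_append reduce_reduce)

lemma reduce_append_left [simp]: "reduce (reduce u @ v) = reduce (u @ v)"
proof (induction u)
  case (Cons x u)
  show ?case
  proof (cases "reduce u")
    case Nil
    then show ?thesis using Cons.IH by simp
  next
    case (Cons y r)
    have "cons_reduce x (cons_reduce (inv_letter x) (reduce (r @ v))) = reduce (r @ v)"
      by (rule cons_reduce_cancel) (rule reduce_reduce)
    then show ?thesis using Cons Cons.IH[symmetric] by auto
  qed
qed simp

lemma reduce_append_right [simp]: "reduce (u @ reduce v) = reduce (u @ v)"
  by (simp add: reduce_append)

lemma reduce_inverse_append: "reduce (map inv_letter (rev w) @ w) = []"
proof (induction w)
  case (Cons x w)
  have "cons_reduce (inv_letter x) (cons_reduce x (reduce w)) = reduce w"
    using cons_reduce_cancel[of "reduce w" "inv_letter x"] by simp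
  then show ?case using Cons by (simp add: reduce_append)
qed simp

lemma group_free_group: "group free_group"
proof (rule groupI)
  fix w :: "'a word"
  assume "w \<in> carrier free_group"
  let ?u = "reduce (map inv_letter (rev w))"
  have "?u \<in> carrier free_group" "?u \<otimes>\<^bsub>free_group\<^esub> w = \<one>\<^bsub>free_group\<^esub>"
    by (auto simp: free_group_def reduce_inverse_append)
  then show "\<exists>u\<in>carrier free_group. u \<otimes>\<^bsub>free_group\<^esub> w = \<one>\<^bsub>free_group\<^esub>" by blast
qed (auto simp: free_group_def)


section \<open>Function algebras and affine varieties\<close>

text \<open>An affine variety is represented by its set of points \<open>X\<close> together with its algebra of
  regular functions; functions on \<open>X\<close> are taken to be undefined outside of \<open>X\<close>.
  The following is the unital complex algebra of functions on \<open>X\<close> generated by the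
  restrictions of the functions in \<open>S\<close>.\<close>

inductive_set function_algebra :: "'a set \<Rightarrow> ('a \<Rightarrow> complex) set \<Rightarrow> ('a \<Rightarrow> complex) set"
  for X :: "'a set" and S :: "('a \<Rightarrow> complex) set" where
  const: "(\<lambda>x\<in>X. c) \<in> function_algebra X S"
| gen: "f \<in> S \<Longrightarrow> restrict f X \<in> function_algebra X S"
| add: "f \<in> function_algebra X S \<Longrightarrow> g \<in> function_algebra X S \<Longrightarrow>
    (\<lambda>x\<in>X. f x + g x) \<in> function_algebra X S"
| mult: "f \<in> function_algebra X S \<Longrightarrow> g \<in> function_algebra X S \<Longrightarrow>
    (\<lambda>x\<in>X. f x * g x) \<in> function_algebra X S"

lemma function_algebra_extensional: "f \<in> function_algebra X S \<Longrightarrow> f \<in> extensional X"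
  by (induction rule: function_algebra.induct) (rule restrict_extensional)+

lemma function_algebra_cong:
  assumes "g \<in> function_algebra X S" "\<And>x. x \<in> X \<Longrightarrow> f x = g x"
  shows "restrict f X \<in> function_algebra X S"
proof -
  have "restrict f X = restrict g X" using assms(2) by (rule restrict_ext)
  also have "\<dots> = g" by (rule extensional_restrict) (rule function_algebra_extensional[OF assms(1)])
  finally show ?thesis using assms(1) by (simp only:)
qed

lemma function_algebra_sum:
  assumes "finite I" "\<And>i. i \<in> I \<Longrightarrow> restrict (f i) X \<in> function_algebra X S"
  shows "(\<lambda>x\<in>X. \<Sum>i\<in>I. f i x) \<in> function_algebra X S"
  using assms
proof (induction I rule: finite_induct)
  case empty
  show ?case by (rule function_algebra_cong[OF function_algebra.const[where X = X and c = 0]]) simp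
next
  case (insert i I)
  have "restrict (f i) X \<in> function_algebra X S"
    and "(\<lambda>x\<in>X. \<Sum>i\<in>I. f i x) \<in> function_algebra X S"
    using insert by blast+
  from function_algebra.add[OF this] show ?case
    by (rule function_algebra_cong) (use insert in simp)
qed

lemma function_algebra_prod:
  assumes "finite I" "\<And>i. i \<in> I \<Longrightarrow> restrict (f i) X \<in> function_algebra X S"
  shows "(\<lambda>x\<in>X. \<Prod>i\<in>I. f i x) \<in> function_algebra X S"
  using assms
proof (induction I rule: finite_induct)
  case empty
  show ?case by (rule function_algebra_cong[OF function_algebra.const[where X = X and c = 1]]) simp
next
  case (insert i I)
  have "restrict (f i) X \<in> function_algebra X S"
    and "(\<lambda>x\<in>X. \<Prod>i\<in>I. f i x) \<in> function_algebra X S"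
    using insert by blast+
  from function_algebra.mult[OF this] show ?case
    by (rule function_algebra_cong) (use insert in simp)
qed

lemma function_algebra_pullback:
  assumes "f \<in> function_algebra Y S" and h: "\<And>x. x \<in> X \<Longrightarrow> h x \<in> Y"
    and S: "\<And>f. f \<in> S \<Longrightarrow> (\<lambda>x\<in>X. f (h x)) \<in> function_algebra X T"
  shows "(\<lambda>x\<in>X. f (h x)) \<in> function_algebra X T"
  using assms(1)
proof (induction rule: function_algebra.induct)
  case (const c)
  show ?case by (rule function_algebra_cong[OF function_algebra.const[where X = X and c = c]]) (simp add: h)
next
  case (gen f)
  show ?case by (rule function_algebra_cong[OF S[OF gen]]) (simp add: h)
next
  case (add f g)
  show ?case by (rule function_algebra_cong[OF function_algebra.add[OF add.IH]]) (simp add: h)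
next
  case (mult f g)
  show ?case by (rule function_algebra_cong[OF function_algebra.mult[OF mult.IH]]) (simp add: h)
qed

record 'a affine_group = "'a monoid" +
  regular :: "('a \<Rightarrow> complex) set"


section \<open>Algebraic matrix groups\<close>

definition general_linear :: "(complex^'d^'d) monoid" where
  "general_linear = \<lparr>carrier = {A. invertible A}, mult = (**), one = mat 1\<rparr>"

lemma invertible_mat_1: "invertible (mat 1 :: complex^'d^'d)"
  unfolding invertible_def by (rule exI[of _ "mat 1"]) simp

lemma group_general_linear: "group (general_linear :: (complex^'d^'d) monoid)"
proof (rule groupI)
  fix A :: "complex^'d^'d"
  assume "A \<in> carrier general_linear"
  then obtain B where "A ** B = mat 1" "B ** A = mat 1"
    by (auto simp: general_linear_def invertible_def)
  then show "\<exists>B\<in>carrier general_linear. B \<otimes>\<^bsub>general_linear\<^esub> A = \<one>\<^bsub>general_linear\<^esub>"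
    by (auto simp: general_linear_def invertible_def)
qed (auto simp: general_linear_def invertible_mult invertible_mat_1 matrix_mul_assoc[symmetric])

definition polynomial_functions :: "(complex^'d^'d \<Rightarrow> complex) set" where
  "polynomial_functions = function_algebra UNIV {\<lambda>A. A $ i $ j | i j. True}"

definition zariski_topology :: "(complex^'d^'d) topology" where
  "zariski_topology = topology_generated_by
     {{A. invertible A \<and> p A \<noteq> 0} | p. p \<in> polynomial_functions}"

definition algebraic_matrix_group :: "(complex^'d^'d) set \<Rightarrow> bool" where
  "algebraic_matrix_group G \<longleftrightarrow> subgroup G general_linear \<and> closedin zariski_topology G"

definition matrix_group :: "(complex^'d^'d) set \<Rightarrow> (complex^'d^'d) affine_group" where
  "matrix_group G = \<lparr>carrier = G, mult = (**), one = mat 1,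
     regular = function_algebra G
       ({\<lambda>A. A $ i $ j | i j. True} \<union> {\<lambda>A. inverse (det A)})\<rparr>"

definition unipotent :: "complex^'d^'d \<Rightarrow> bool" where
  "unipotent A \<longleftrightarrow> (\<exists>k. (((**) (A - mat 1)) ^^ k) (mat 1) = 0)"

text \<open>Triviality of the unipotent radical. Reductive groups are not required to be connected.\<close>

definition reductive :: "(complex^'d^'d) set \<Rightarrow> bool" where
  "reductive G \<longleftrightarrow> algebraic_matrix_group G \<and>
     (\<forall>U. U \<lhd> matrix_group G \<and> closedin zariski_topology U \<and> connectedin zariski_topology U \<and>
        (\<forall>A\<in>U. unipotent A) \<longrightarrow> U = {mat 1})"

text \<open>The quotient of an affine algebraic group by a finite normal subgroup: its regular functions
  are the functions on the cosets whose pullback is regular, that is,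
  \<open>\<complex>[Q/H] = \<complex>[Q]\<^sup>H\<close>.\<close>

definition quotient_group :: "('a, 'b) affine_group_scheme \<Rightarrow> 'a set \<Rightarrow> 'a set affine_group" where
  "quotient_group Q H = \<lparr>carrier = carrier (Q Mod H), mult = mult (Q Mod H), one = one (Q Mod H),
     regular = {f \<in> extensional (carrier (Q Mod H)).
       (\<lambda>a\<in>carrier Q. f (H #>\<^bsub>Q\<^esub> a)) \<in> regular Q}\<rparr>"


section \<open>Character varieties\<close>

text \<open>The index type \<open>'n\<close> is that of the generators, and a homomorphism from the free group is
  identified with the tuple of the images of the generators.\<close>

definition rep_space :: "('a, 'b) affine_group_scheme \<Rightarrow> ('n \<Rightarrow> 'a) set" where
  "rep_space Q = {\<rho>. \<forall>i. \<rho> i \<in> carrier Q}"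

definition eval_rep :: "('a, 'b) monoid_scheme \<Rightarrow> ('n \<Rightarrow> 'a) \<Rightarrow> 'n word \<Rightarrow> 'a" where
  "eval_rep Q \<rho> g =
     foldr (\<lambda>(i, b) a. (if b then \<rho> i else inv\<^bsub>Q\<^esub> (\<rho> i)) \<otimes>\<^bsub>Q\<^esub> a) g \<one>\<^bsub>Q\<^esub>"

lemma eval_rep_hom:
  assumes "group Q" "\<And>i. \<rho> i \<in> carrier Q"
  shows "eval_rep Q \<rho> \<in> hom free_group Q"
proof -
  interpret group Q by (rule assms(1))
  define l where "l x = (if snd x then \<rho> (fst x) else inv\<^bsub>Q\<^esub> (\<rho> (fst x)))" for x
  have l: "l x \<in> carrier Q" "l x \<otimes>\<^bsub>Q\<^esub> l (inv_letter x) = \<one>\<^bsub>Q\<^esub>" for x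
    using assms(2) by (auto simp: l_def inv_letter_def)
  have Nil: "eval_rep Q \<rho> [] = \<one>\<^bsub>Q\<^esub>" by (simp add: eval_rep_def)
  have Cons: "eval_rep Q \<rho> (x # w) = l x \<otimes>\<^bsub>Q\<^esub> eval_rep Q \<rho> w" for x w
    by (cases x) (simp add: eval_rep_def l_def)
  have closed: "eval_rep Q \<rho> w \<in> carrier Q" for w
    by (induction w) (simp_all add: Nil Cons l)
  have red: "eval_rep Q \<rho> (cons_reduce x w) = l x \<otimes>\<^bsub>Q\<^esub> eval_rep Q \<rho> w" for x w
    by (cases w) (auto simp: Nil Cons l closed m_assoc[symmetric])
  have reduce: "eval_rep Q \<rho> (reduce w) = eval_rep Q \<rho> w" for w
    by (induction w) (simp_all add: red Cons)
  have "eval_rep Q \<rho> (u @ v) = eval_rep Q \<rho> u \<otimes>\<^bsub>Q\<^esub> eval_rep Q \<rho> v" for u v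
    by (induction u) (simp_all add: Nil Cons l closed m_assoc)
  then show ?thesis by (intro homI) (simp_all add: closed reduce free_group_def)
qed

text \<open>Regular functions on a product of copies of \<open>Q\<close>: since
  \<open>\<complex>[Q\<^sup>N] = \<complex>[Q] \<otimes> \<dots> \<otimes> \<complex>[Q]\<close>, they are generated
  by the pullbacks of regular functions along the coordinate projections.\<close>

definition rep_functions :: "('a, 'b) affine_group_scheme \<Rightarrow> (('n \<Rightarrow> 'a) \<Rightarrow> complex) set" where
  "rep_functions Q = function_algebra (rep_space Q) {\<lambda>\<rho>. f (\<rho> i) | f i. f \<in> regular Q}"

definition conjugate_rep :: "('a, 'b) monoid_scheme \<Rightarrow> 'a \<Rightarrow> ('n \<Rightarrow> 'a) \<Rightarrow> 'n \<Rightarrow> 'a" where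
  "conjugate_rep Q a \<rho> = (\<lambda>i. a \<otimes>\<^bsub>Q\<^esub> \<rho> i \<otimes>\<^bsub>Q\<^esub> inv\<^bsub>Q\<^esub> a)"

definition invariants :: "('a, 'b) affine_group_scheme \<Rightarrow> (('n \<Rightarrow> 'a) \<Rightarrow> complex) set" where
  "invariants Q = {f \<in> rep_functions Q.
     \<forall>a\<in>carrier Q. \<forall>\<rho>\<in>rep_space Q. f (conjugate_rep Q a \<rho>) = f \<rho>}"

text \<open>For reductive \<open>Q\<close>, the points of the categorical quotient \<open>Q\<^sup>N // Q\<close>
  (the maximal spectrum of the algebra of invariants) correspond to the classes of tuples that are
  not separated by invariant regular functions.\<close>

definition rep_class :: "('a, 'b) affine_group_scheme \<Rightarrow> ('n \<Rightarrow> 'a) \<Rightarrow> ('n \<Rightarrow> 'a) set" where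
  "rep_class Q \<rho> = {\<sigma> \<in> rep_space Q. \<forall>f\<in>invariants Q. f \<sigma> = f \<rho>}"

definition char_variety :: "('a, 'b) affine_group_scheme \<Rightarrow> ('n \<Rightarrow> 'a) set set" where
  "char_variety Q = rep_class Q ` rep_space Q"

definition coordinate_ring :: "('a, 'b) affine_group_scheme \<Rightarrow> (('n \<Rightarrow> 'a) set \<Rightarrow> complex) set" where
  "coordinate_ring Q = {f \<in> extensional (char_variety Q).
     (\<lambda>\<rho>\<in>rep_space Q. f (rep_class Q \<rho>)) \<in> invariants Q}"

definition trace_function :: "(complex^'d^'d) set \<Rightarrow> 'n word \<Rightarrow> ('n \<Rightarrow> complex^'d^'d) set \<Rightarrow> complex" where
  "trace_function G g = (\<lambda>x\<in>char_variety (matrix_group G).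
     the_elem ((\<lambda>\<rho>. trace (eval_rep (matrix_group G) \<rho> g)) ` x))"

definition induced_map ::
    "('a, 'b) affine_group_scheme \<Rightarrow> 'a set \<Rightarrow> ('n \<Rightarrow> 'a) set \<Rightarrow> ('n \<Rightarrow> 'a set) set" where
  "induced_map Q H = (\<lambda>x\<in>char_variety Q.
     the_elem ((\<lambda>\<rho>. rep_class (quotient_group Q H) (\<lambda>i. H #>\<^bsub>Q\<^esub> \<rho> i)) ` x))"

text \<open>Pullback along \<open>Q\<^sup>N \<rightarrow> Q\<^sup>N // Q\<close> identifies the coordinate ring of the character
  variety with the algebra of invariants, and the functions and maps defined through
  \<^const>\<open>the_elem\<close> do not depend on the chosen representative.\<close>

lemma rep_class_eqI:
  fixes \<rho> \<sigma> :: "'n \<Rightarrow> 'a"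
  assumes "\<And>f. f \<in> invariants Q \<Longrightarrow> f \<sigma> = f \<rho>"
  shows "rep_class Q \<sigma> = rep_class Q \<rho>"
proof -
  have "(\<forall>f\<in>invariants Q. f \<sigma>' = f \<sigma>) \<longleftrightarrow> (\<forall>f\<in>invariants Q. f \<sigma>' = f \<rho>)" for \<sigma>'
  proof (rule ball_cong[OF refl])
    fix f :: "('n \<Rightarrow> 'a) \<Rightarrow> complex"
    assume "f \<in> invariants Q"
    from assms[OF this] show "f \<sigma>' = f \<sigma> \<longleftrightarrow> f \<sigma>' = f \<rho>" by (simp only:)
  qed
  then show ?thesis by (simp only: rep_class_def)
qed

lemma the_elem_rep_class:
  assumes "\<rho> \<in> rep_space Q" "\<And>\<sigma>. \<sigma> \<in> rep_class Q \<rho> \<Longrightarrow> h \<sigma> = h \<rho>"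
  shows "the_elem (h ` rep_class Q \<rho>) = h \<rho>"
proof -
  have "\<rho> \<in> rep_class Q \<rho>" using assms(1) by (simp add: rep_class_def)
  then have "h ` rep_class Q \<rho> = {h \<rho>}"
    by (intro equalityI image_subsetI) (use assms(2) in blast)+
  then show ?thesis by simp
qed

lemma bij_betw_coordinate_ring:
  fixes Q :: "('a, 'b) affine_group_scheme"
  shows "bij_betw (\<lambda>f. \<lambda>\<rho>\<in>rep_space Q. f (rep_class Q \<rho>))
    (coordinate_ring Q :: (('c \<Rightarrow> 'a) set \<Rightarrow> complex) set) (invariants Q)"
    (is "bij_betw ?P ?C ?I")
proof (rule bij_betw_imageI)
  show "inj_on ?P ?C"
  proof (rule inj_onI)
    fix f g :: "('c \<Rightarrow> 'a) set \<Rightarrow> complex"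
    assume fg: "f \<in> ?C" "g \<in> ?C"
      and eq: "(\<lambda>\<rho>\<in>rep_space Q. f (rep_class Q \<rho>)) = (\<lambda>\<rho>\<in>rep_space Q. g (rep_class Q \<rho>))"
    show "f = g"
    proof (rule extensionalityI)
      show "f \<in> extensional (char_variety Q)" "g \<in> extensional (char_variety Q)"
        using fg by (auto simp: coordinate_ring_def)
      show "f x = g x" if "x \<in> char_variety Q" for x
      proof -
        from that obtain \<rho> where \<rho>: "\<rho> \<in> rep_space Q" "x = rep_class Q \<rho>"
          by (auto simp: char_variety_def)
        then show ?thesis using fun_cong[OF eq, of \<rho>] by simp
      qed
    qed
  qed
  show "?P ` ?C = ?I"
  proof (intro equalityI subsetI)
    fix h :: "('c \<Rightarrow> 'a) \<Rightarrow> complex"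
    assume h: "h \<in> ?I"
    define f where "f = (\<lambda>x\<in>char_variety Q. the_elem (h ` x))"
    have f: "f (rep_class Q \<rho>) = h \<rho>" if "\<rho> \<in> rep_space Q" for \<rho>
    proof -
      have "the_elem (h ` rep_class Q \<rho>) = h \<rho>"
        by (rule the_elem_rep_class[OF that]) (use h in \<open>unfold rep_class_def, blast\<close>)
      then show ?thesis using that by (simp add: f_def char_variety_def)
    qed
    have "h \<in> extensional (rep_space Q)"
      using h function_algebra_extensional unfolding invariants_def rep_functions_def by blast
    then have eq: "(\<lambda>\<rho>\<in>rep_space Q. f (rep_class Q \<rho>)) = h"
      by (intro extensionalityI[of _ "rep_space Q"]) (rule restrict_extensional, assumption, simp add: f)
    have "f \<in> extensional (char_variety Q)" unfolding f_def by (rule restrict_extensional)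
    then have "f \<in> coordinate_ring Q" unfolding coordinate_ring_def mem_Collect_eq eq using h by blast
    then show "h \<in> ?P ` ?C"
      by (rule rev_image_eqI) (rule eq[symmetric])
  next
    fix h assume "h \<in> ?P ` ?C"
    then show "h \<in> ?I" unfolding coordinate_ring_def by blast
  qed
qed

lemma invariants_pullback:
  fixes Q :: "('a, 'b) affine_group_scheme"
    and f :: "('c \<Rightarrow> 'a set) \<Rightarrow> complex"
  assumes H: "H \<lhd> Q" and f: "f \<in> invariants (quotient_group Q H)"
  shows "(\<lambda>\<rho>\<in>rep_space Q. f (\<lambda>i. H #>\<^bsub>Q\<^esub> \<rho> i)) \<in> invariants Q"
proof -
  interpret normal H Q by (rule H)
  have coset: "H #>\<^bsub>Q\<^esub> a \<in> carrier (Q Mod H)" if "a \<in> carrier Q" for a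
    unfolding carrier_FactGroup using that by (rule imageI)
  have rep: "(\<lambda>i. H #>\<^bsub>Q\<^esub> \<rho> i) \<in> rep_space (quotient_group Q H)" if "\<rho> \<in> rep_space Q" for \<rho> :: "'c \<Rightarrow> 'a"
    using that coset by (simp add: rep_space_def quotient_group_def)
  have "(\<lambda>\<rho>\<in>rep_space Q. f (\<lambda>i. H #>\<^bsub>Q\<^esub> \<rho> i)) \<in> rep_functions Q"
    unfolding rep_functions_def
  proof (rule function_algebra_pullback[where f = f and h = "\<lambda>\<rho> i. H #>\<^bsub>Q\<^esub> \<rho> i"])
    show "f \<in> function_algebra (rep_space (quotient_group Q H))
        {\<lambda>\<rho>. f (\<rho> i) | f i. f \<in> regular (quotient_group Q H)}"
      using f by (simp add: invariants_def rep_functions_def)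
    fix g assume "g \<in> {\<lambda>\<rho> :: 'c \<Rightarrow> 'a set. f (\<rho> i) | f i. f \<in> regular (quotient_group Q H)}"
    then obtain p i where g: "g = (\<lambda>\<rho>. p (\<rho> i))" and "p \<in> regular (quotient_group Q H)" by blast
    then have "(\<lambda>a\<in>carrier Q. p (H #>\<^bsub>Q\<^esub> a)) \<in> regular Q" by (simp add: quotient_group_def)
    then have "(\<lambda>\<rho>. (\<lambda>a\<in>carrier Q. p (H #>\<^bsub>Q\<^esub> a)) (\<rho> i))
        \<in> {\<lambda>\<rho> :: 'c \<Rightarrow> 'a. f (\<rho> i) | f i. f \<in> regular Q}" by blast
    from function_algebra.gen[OF this, of "rep_space Q"]
    show "(\<lambda>\<rho>\<in>rep_space Q. g (\<lambda>i. H #>\<^bsub>Q\<^esub> \<rho> i))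
        \<in> function_algebra (rep_space Q) {\<lambda>\<rho>. f (\<rho> i) | f i. f \<in> regular Q}"
      by (rule function_algebra_cong) (simp add: g rep_space_def)
  qed (rule rep)
  moreover have "f (\<lambda>i. H #>\<^bsub>Q\<^esub> conjugate_rep Q a \<rho> i) = f (\<lambda>i. H #>\<^bsub>Q\<^esub> \<rho> i)"
    and "conjugate_rep Q a \<rho> \<in> rep_space Q"
    if a: "a \<in> carrier Q" and \<rho>: "\<rho> \<in> rep_space Q" for a and \<rho> :: "'c \<Rightarrow> 'a"
  proof -
    have inv_quot: "inv\<^bsub>quotient_group Q H\<^esub> (H #>\<^bsub>Q\<^esub> a) = H #>\<^bsub>Q\<^esub> inv\<^bsub>Q\<^esub> a"
    proof -
      have "inv\<^bsub>quotient_group Q H\<^esub> (H #>\<^bsub>Q\<^esub> a) = inv\<^bsub>Q Mod H\<^esub> (H #>\<^bsub>Q\<^esub> a)"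
        by (simp add: m_inv_def quotient_group_def)
      also have "\<dots> = H #>\<^bsub>Q\<^esub> inv\<^bsub>Q\<^esub> a"
        using a coset by (simp add: inv_FactGroup rcos_inv)
      finally show ?thesis .
    qed
    have "(\<lambda>i. H #>\<^bsub>Q\<^esub> conjugate_rep Q a \<rho> i)
        = conjugate_rep (quotient_group Q H) (H #>\<^bsub>Q\<^esub> a) (\<lambda>i. H #>\<^bsub>Q\<^esub> \<rho> i)"
      using a \<rho> unfolding conjugate_rep_def inv_quot
      by (simp add: quotient_group_def rcos_sum rep_space_def)
    moreover have "H #>\<^bsub>Q\<^esub> a \<in> carrier (quotient_group Q H)"
      using coset[OF a] by (simp add: quotient_group_def)
    ultimately show "f (\<lambda>i. H #>\<^bsub>Q\<^esub> conjugate_rep Q a \<rho> i) = f (\<lambda>i. H #>\<^bsub>Q\<^esub> \<rho> i)"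
      using f rep[OF \<rho>] by (simp add: invariants_def)
    show "conjugate_rep Q a \<rho> \<in> rep_space Q"
      using a \<rho> by (simp add: conjugate_rep_def rep_space_def)
  qed
  ultimately show ?thesis by (simp add: invariants_def)
qed

lemma induced_map_rep_class:
  fixes Q :: "('a, 'b) affine_group_scheme"
    and \<rho> :: "'c \<Rightarrow> 'a"
  assumes H: "H \<lhd> Q" and \<rho>: "\<rho> \<in> rep_space Q"
  shows "induced_map Q H (rep_class Q \<rho>) = rep_class (quotient_group Q H) (\<lambda>i. H #>\<^bsub>Q\<^esub> \<rho> i)"
proof -
  have "the_elem ((\<lambda>\<rho>. rep_class (quotient_group Q H) (\<lambda>i. H #>\<^bsub>Q\<^esub> \<rho> i)) ` rep_class Q \<rho>)
      = rep_class (quotient_group Q H) (\<lambda>i. H #>\<^bsub>Q\<^esub> \<rho> i)"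
  proof (rule the_elem_rep_class[OF \<rho>], rule rep_class_eqI)
    fix \<sigma> :: "'c \<Rightarrow> 'a" and f :: "('c \<Rightarrow> 'a set) \<Rightarrow> complex"
    assume \<sigma>: "\<sigma> \<in> rep_class Q \<rho>"
      and f: "f \<in> invariants (quotient_group Q H)"
    have "(\<lambda>\<rho>\<in>rep_space Q. f (\<lambda>i. H #>\<^bsub>Q\<^esub> \<rho> i)) \<sigma>
        = (\<lambda>\<rho>\<in>rep_space Q. f (\<lambda>i. H #>\<^bsub>Q\<^esub> \<rho> i)) \<rho>"
      using \<sigma> invariants_pullback[OF H f] unfolding rep_class_def by blast
    then show "f (\<lambda>i. H #>\<^bsub>Q\<^esub> \<sigma> i) = f (\<lambda>i. H #>\<^bsub>Q\<^esub> \<rho> i)"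
      using \<sigma> \<rho> by (simp add: rep_class_def)
  qed
  then show ?thesis using \<rho> by (simp add: induced_map_def char_variety_def)
qed

lemma group_matrix_group:
  assumes "subgroup G general_linear"
  shows "group (matrix_group G)"
proof -
  have "group (general_linear\<lparr>carrier := G\<rparr>)"
    by (rule subgroup.subgroup_is_group[OF assms group_general_linear])
  then show ?thesis
    by (simp add: group_def monoid_def group_axioms_def Units_def general_linear_def matrix_group_def)
qed

lemma regular_inverse_entry:
  assumes "subgroup G general_linear"
  shows "(\<lambda>A\<in>G. (inv\<^bsub>matrix_group G\<^esub> A) $ i $ j) \<in> regular (matrix_group G)"
proof -
  interpret group "matrix_group G" by (rule group_matrix_group[OF assms])
  let ?S = "{\<lambda>A. A $ i $ j | i j. True} \<union> {\<lambda>A. inverse (det A)}"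
  define M where "M A = (\<chi> k l. if l = i then axis j 1 $ k else A $ k $ l)" for A :: "complex^'a^'a"
  have entry: "restrict (\<lambda>A. M A $ k $ l) G \<in> function_algebra G ?S" for k l
  proof (cases "l = i")
    case True
    show ?thesis
      by (rule function_algebra_cong[OF function_algebra.const[where X = G and c = "axis j 1 $ k"]])
        (simp add: M_def True)
  next
    case False
    have "(\<lambda>A. A $ k $ l) \<in> ?S" by blast
    from function_algebra.gen[OF this, of G] show ?thesis
      by (rule function_algebra_cong) (simp add: M_def False)
  qed
  have "(\<lambda>A\<in>G. of_int (sign p) * (\<Prod>k\<in>UNIV. M A $ k $ p k)) \<in> function_algebra G ?S" for p
  proof -
    have "(\<lambda>A\<in>G. \<Prod>k\<in>UNIV. M A $ k $ p k) \<in> function_algebra G ?S"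
      by (rule function_algebra_prod) (simp, rule entry)
    from function_algebra.mult[OF function_algebra.const this, of "of_int (sign p)"]
    show ?thesis by (rule function_algebra_cong) simp
  qed
  then have "(\<lambda>A\<in>G. \<Sum>p\<in>{p. p permutes UNIV}. of_int (sign p) * (\<Prod>k\<in>UNIV. M A $ k $ p k))
      \<in> function_algebra G ?S"
    by (intro function_algebra_sum finite_permutations) simp
  moreover have "(\<lambda>A\<in>G. inverse (det A)) \<in> function_algebra G ?S"
    by (rule function_algebra.gen) simp
  ultimately have "(\<lambda>A\<in>G. (inv\<^bsub>matrix_group G\<^esub> A) $ i $ j) \<in> function_algebra G ?S"
  proof (rule function_algebra_cong[OF function_algebra.mult])
    fix A assume A: "A \<in> G"
    define B where "B = inv\<^bsub>matrix_group G\<^esub> A"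
    have "A ** B = mat 1" using A r_inv[of A] by (simp add: B_def matrix_group_def)
    then have "A *v (B *v axis j 1) = axis j 1" by (simp add: matrix_vector_mul_assoc)
    moreover have "invertible A"
      using subgroup.subset[OF assms] A by (auto simp: general_linear_def)
    ultimately have "B *v axis j 1
        = (\<chi> k. det (\<chi> r l. if l = k then axis j 1 $ r else A $ r $ l) / det A)"
      using cramer[of A "B *v axis j 1" "axis j 1"] by (simp add: invertible_det_nz)
    from arg_cong[OF this, of "\<lambda>v. v $ i"]
    have "(B *v axis j 1) $ i = det (M A) * inverse (det A)"
      by (simp add: M_def divide_inverse)
    moreover have "(B *v axis j 1) $ i = B $ i $ j"
      unfolding matrix_vector_mult_def axis_def by (simp add: if_distrib sum.delta cong: if_cong)
    ultimately have "B $ i $ j = det (M A) * inverse (det A)" by simp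
    then show "(inv\<^bsub>matrix_group G\<^esub> A) $ i $ j
        = (\<lambda>B\<in>G. (\<lambda>A\<in>G. \<Sum>p\<in>{p. p permutes UNIV}. of_int (sign p) * (\<Prod>k\<in>UNIV. M A $ k $ p k)) B *
          (\<lambda>A\<in>G. inverse (det A)) B) A"
      using A by (simp add: B_def det_def)
  qed
  then show ?thesis by (simp add: matrix_group_def)
qed

lemma eval_rep_entry_regular:
  assumes "subgroup G general_linear"
  shows "(\<lambda>\<rho>\<in>rep_space (matrix_group G). eval_rep (matrix_group G) \<rho> g $ i $ j)
    \<in> rep_functions (matrix_group G)"
proof (induction g arbitrary: i j)
  case Nil
  show ?case unfolding rep_functions_def
    by (rule function_algebra_cong[OF function_algebra.const[where c = "mat 1 $ i $ j"]])
      (simp add: eval_rep_def matrix_group_def)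
next
  case (Cons x g)
  obtain r b where x: "x = (r, b)" by (cases x)
  let ?Q = "matrix_group G"
  define L where "L \<rho> = (if b then \<rho> r else inv\<^bsub>?Q\<^esub> (\<rho> r))" for \<rho> :: "'b \<Rightarrow> complex^'a^'a"
  have L: "(\<lambda>\<rho>\<in>rep_space ?Q. L \<rho> $ k $ l) \<in> rep_functions ?Q" for k l
  proof -
    define p where "p = (\<lambda>A\<in>G. (if b then A else inv\<^bsub>?Q\<^esub> A) $ k $ l)"
    have "p \<in> regular ?Q"
    proof (cases b)
      case True
      have "(\<lambda>A. A $ k $ l) \<in> {\<lambda>A. A $ i $ j | i j. True} \<union> {\<lambda>A. inverse (det A)}" by blast
      from function_algebra.gen[OF this, of G] show ?thesis by (simp add: p_def True matrix_group_def)
    next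
      case False
      then show ?thesis using regular_inverse_entry[OF assms, of k l] by (simp add: p_def)
    qed
    then have "(\<lambda>\<rho>. p (\<rho> r)) \<in> {\<lambda>\<rho> :: 'b \<Rightarrow> complex^'a^'a. f (\<rho> i) | f i. f \<in> regular ?Q}" by blast
    from function_algebra.gen[OF this, of "rep_space ?Q"] show ?thesis unfolding rep_functions_def
      by (rule function_algebra_cong) (simp add: p_def L_def rep_space_def matrix_group_def)
  qed
  have "(\<lambda>\<rho>\<in>rep_space ?Q. L \<rho> $ i $ k * eval_rep ?Q \<rho> g $ k $ j) \<in> rep_functions ?Q" for k
    using function_algebra.mult[OF L[of i k, unfolded rep_functions_def]
        Cons.IH[of k j, unfolded rep_functions_def]]
    unfolding rep_functions_def by (rule function_algebra_cong) simp
  then have "(\<lambda>\<rho>\<in>rep_space ?Q. \<Sum>k\<in>UNIV. L \<rho> $ i $ k * eval_rep ?Q \<rho> g $ k $ j) \<in> rep_functions ?Q"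
    unfolding rep_functions_def by (intro function_algebra_sum) simp_all
  then show ?case unfolding rep_functions_def
    by (rule function_algebra_cong)
      (simp add: x L_def eval_rep_def matrix_group_def matrix_matrix_mult_def)
qed

lemma trace_invariant:
  assumes G: "subgroup G general_linear"
  shows "(\<lambda>\<rho>\<in>rep_space (matrix_group G). trace (eval_rep (matrix_group G) \<rho> g))
    \<in> invariants (matrix_group G)"
proof -
  let ?Q = "matrix_group G"
  interpret group ?Q by (rule group_matrix_group[OF G])
  have "(\<lambda>\<rho>\<in>rep_space ?Q. trace (eval_rep ?Q \<rho> g)) \<in> rep_functions ?Q"
    unfolding trace_def rep_functions_def
    by (rule function_algebra_sum) (simp, rule eval_rep_entry_regular[OF G, unfolded rep_functions_def])
  moreover have "conjugate_rep ?Q a \<rho> \<in> rep_space ?Q"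
    and "trace (eval_rep ?Q (conjugate_rep ?Q a \<rho>) g) = trace (eval_rep ?Q \<rho> g)"
    if a: "a \<in> carrier ?Q" and \<rho>: "\<rho> \<in> rep_space ?Q" for a and \<rho> :: "'b \<Rightarrow> complex^'a^'a"
  proof -
    have r: "\<rho> i \<in> carrier ?Q" for i using \<rho> by (simp add: rep_space_def)
    show "conjugate_rep ?Q a \<rho> \<in> rep_space ?Q"
      using a r by (simp add: conjugate_rep_def rep_space_def)
    have "eval_rep ?Q \<rho> g \<in> carrier ?Q \<and>
      eval_rep ?Q (conjugate_rep ?Q a \<rho>) g = a \<otimes>\<^bsub>?Q\<^esub> eval_rep ?Q \<rho> g \<otimes>\<^bsub>?Q\<^esub> inv\<^bsub>?Q\<^esub> a"
    proof (induction g)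
      case Nil
      show ?case using a by (simp add: eval_rep_def)
    next
      case (Cons x g)
      obtain i b where x: "x = (i, b)" by (cases x)
      define l where "l = (if b then \<rho> i else inv\<^bsub>?Q\<^esub> (\<rho> i))"
      have l: "l \<in> carrier ?Q" using r by (simp add: l_def)
      have conj: "(if b then conjugate_rep ?Q a \<rho> i else inv\<^bsub>?Q\<^esub> (conjugate_rep ?Q a \<rho> i))
          = a \<otimes>\<^bsub>?Q\<^esub> l \<otimes>\<^bsub>?Q\<^esub> inv\<^bsub>?Q\<^esub> a"
        using a r by (simp add: l_def conjugate_rep_def inv_mult_group m_assoc)
      have e: "eval_rep ?Q \<rho> (x # g) = l \<otimes>\<^bsub>?Q\<^esub> eval_rep ?Q \<rho> g"
        by (simp add: eval_rep_def x l_def)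
      have "eval_rep ?Q (conjugate_rep ?Q a \<rho>) (x # g)
          = (a \<otimes>\<^bsub>?Q\<^esub> l \<otimes>\<^bsub>?Q\<^esub> inv\<^bsub>?Q\<^esub> a) \<otimes>\<^bsub>?Q\<^esub> eval_rep ?Q (conjugate_rep ?Q a \<rho>) g"
        unfolding conj[symmetric] by (simp add: eval_rep_def x)
      then show ?case using Cons.IH a l unfolding e
        by (simp add: m_assoc) (simp add: m_assoc[symmetric])
    qed
    then have "eval_rep ?Q (conjugate_rep ?Q a \<rho>) g = (a ** eval_rep ?Q \<rho> g) ** inv\<^bsub>?Q\<^esub> a"
      by (simp add: matrix_group_def)
    moreover have "inv\<^bsub>?Q\<^esub> a ** a = mat 1" using l_inv[OF a] by (simp add: matrix_group_def)
    ultimately show "trace (eval_rep ?Q (conjugate_rep ?Q a \<rho>) g) = trace (eval_rep ?Q \<rho> g)"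
      using trace_mul_sym[of "a ** eval_rep ?Q \<rho> g" "inv\<^bsub>?Q\<^esub> a"] by (simp add: matrix_mul_assoc)
  qed
  ultimately show ?thesis by (simp add: invariants_def)
qed

lemma trace_function_rep_class:
  assumes G: "subgroup G general_linear" and \<rho>: "\<rho> \<in> rep_space (matrix_group G)"
  shows "trace_function G g (rep_class (matrix_group G) \<rho>) = trace (eval_rep (matrix_group G) \<rho> g)"
proof -
  let ?Q = "matrix_group G"
  have "the_elem ((\<lambda>\<rho>. trace (eval_rep ?Q \<rho> g)) ` rep_class ?Q \<rho>) = trace (eval_rep ?Q \<rho> g)"
  proof (rule the_elem_rep_class[OF \<rho>])
    fix \<sigma> assume \<sigma>: "\<sigma> \<in> rep_class ?Q \<rho>"
    have "(\<lambda>\<rho>\<in>rep_space ?Q. trace (eval_rep ?Q \<rho> g)) \<sigma> = (\<lambda>\<rho>\<in>rep_space ?Q. trace (eval_rep ?Q \<rho> g)) \<rho>"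
      using \<sigma> trace_invariant[OF G, of g] unfolding rep_class_def by blast
    then show "trace (eval_rep ?Q \<sigma> g) = trace (eval_rep ?Q \<rho> g)"
      using \<sigma> \<rho> by (simp add: rep_class_def)
  qed
  then show ?thesis using \<rho> by (simp add: trace_function_def char_variety_def)
qed

definition is_trace_descent :: "(complex^'d^'d) set \<Rightarrow> (complex^'d^'d) set \<Rightarrow> 'n word list \<Rightarrow>
    (('n \<Rightarrow> (complex^'d^'d) set) set \<Rightarrow> complex) \<Rightarrow> bool" where
  "is_trace_descent G H gs l \<longleftrightarrow>
     l \<in> coordinate_ring (quotient_group (matrix_group G) H) \<and>
     (\<forall>x\<in>char_variety (matrix_group G).
        (\<Prod>g\<leftarrow>gs. trace_function G g x) = l (induced_map (matrix_group G) H x))"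

definition trace_descent :: "(complex^'d^'d) set \<Rightarrow> (complex^'d^'d) set \<Rightarrow> 'n word list \<Rightarrow>
    (('n \<Rightarrow> (complex^'d^'d) set) set \<Rightarrow> complex)" where
  "trace_descent G H gs = (THE l. is_trace_descent G H gs l)"

end

theory Submission
  imports Defs
begin

text \<open>The idea is to average over the finite group \<open>H\<^sup>N\<close>, which acts on \<open>G\<^sup>N\<close> by multiplying each
  coordinate with a scalar and whose orbits are the fibres of \<open>G\<^sup>N \<rightarrow> (G/H)\<^sup>N\<close>.

  A regular function on \<open>G\<^sup>N\<close> that is constant on the fibres is regular on \<open>(G/H)\<^sup>N\<close>: it equals its
  own fibre average, and fibre sums of regular functions are regular on the quotient
  (\<open>fibre_sum_in_rep_functions\<close>). The latter reduces to products \<open>\<Prod>\<^sub>i p\<^sub>i(\<rho>\<^sub>i)\<close>, for which the sum over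
  the fibre factors into sums over single cosets. Since \<open>G/H\<close>-invariance is the same as
  \<open>G\<close>-invariance of the pullback, functions in the coordinate ring of \<open>X\<^sub>G(F\<^sub>N)\<close> that are constant
  on the fibres descend uniquely to \<open>X\<^bsub>G/H\<^esub>(F\<^sub>N)\<close> (\<open>coordinate_ring_descend\<close>).

  Multiplying \<open>\<rho>\<^sub>i\<close> by the scalar \<open>c\<^sub>i\<close> multiplies \<open>\<rho>(g)\<close> by \<open>\<Prod>\<^sub>i c\<^sub>i\<^sup>e\<close> with \<open>e\<close> the exponent sum of \<open>\<gamma>\<^sub>i\<close>
  in \<open>g\<close>. So a product of traces is an eigenvector of \<open>H\<^sup>N\<close> whose character is given by the total
  exponent vector. If this vector vanishes modulo \<open>m\<close>, the character is trivial and the product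
  descends, which gives the first part. Otherwise the character is nontrivial, because the
  polynomial \<open>z\<^sup>r - 1\<close> with \<open>0 < r < m\<close> cannot vanish on all \<open>m\<close> scalars of \<open>H\<close>, and the
  average of the product over every fibre is zero.

  For the second part, pull a regular function on \<open>X\<^bsub>G/H\<^esub>(F\<^sub>N)\<close> back to \<open>X\<^sub>G(F\<^sub>N)\<close> and write it as a linear
  combination of products of the generating traces. Averaging does not change the
  function, but removes every product with nonzero exponent vector; what remains is a linear
  combination of pullbacks of functions \<open>\<lambda>\<close> (\<open>coordinate_ring_quotient_generated\<close>).\<close>

section \<open>Function algebras\<close>

lemma function_algebra_monomials:
  assumes "f \<in> function_algebra X S"
  shows "\<exists>ms. (\<forall>(c, fs)\<in>set ms. set fs \<subseteq> S) \<and>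
    f = (\<lambda>x\<in>X. \<Sum>(c, fs)\<leftarrow>ms. c * (\<Prod>g\<leftarrow>fs. g x))"
  using assms
proof (induction rule: function_algebra.induct)
  case (const c)
  show ?case by (rule exI[of _ "[(c, [])]"]) simp
next
  case (gen f)
  show ?case by (rule exI[of _ "[(1, [f])]"]) (simp add: gen)
next
  case (add f g)
  then obtain ms ns where "\<forall>(c, fs)\<in>set ms. set fs \<subseteq> S" "\<forall>(c, fs)\<in>set ns. set fs \<subseteq> S"
    "f = (\<lambda>x\<in>X. \<Sum>(c, fs)\<leftarrow>ms. c * (\<Prod>g\<leftarrow>fs. g x))"
    "g = (\<lambda>x\<in>X. \<Sum>(c, fs)\<leftarrow>ns. c * (\<Prod>g\<leftarrow>fs. g x))"
    by blast
  then show ?case by (intro exI[of _ "ms @ ns"]) (auto intro!: restrict_ext)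
next
  case (mult f g)
  then obtain ms ns where mn: "\<forall>(c, fs)\<in>set ms. set fs \<subseteq> S" "\<forall>(c, fs)\<in>set ns. set fs \<subseteq> S"
    "f = (\<lambda>x\<in>X. \<Sum>(c, fs)\<leftarrow>ms. c * (\<Prod>g\<leftarrow>fs. g x))"
    "g = (\<lambda>x\<in>X. \<Sum>(c, fs)\<leftarrow>ns. c * (\<Prod>g\<leftarrow>fs. g x))"
    by blast
  \<comment> \<open>the distributive law: each term of the first combination times the whole second one\<close>
  define scaled where "scaled = (\<lambda>(c, fs). map (\<lambda>(d, gs). (c * d, fs @ gs)) ns)"
  have scaled: "(\<Sum>(d, gs)\<leftarrow>scaled (c, fs). d * (\<Prod>g\<leftarrow>gs. g x))
      = c * (\<Prod>g\<leftarrow>fs. g x) * (\<Sum>(d, gs)\<leftarrow>ns. d * (\<Prod>g\<leftarrow>gs. g x))" for c fs x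
    unfolding scaled_def by (induction ns) (auto simp: algebra_simps)
  have "(\<Sum>(d, gs)\<leftarrow>concat (map scaled ms). d * (\<Prod>g\<leftarrow>gs. g x))
      = (\<Sum>(c, fs)\<leftarrow>ms. c * (\<Prod>g\<leftarrow>fs. g x)) * (\<Sum>(d, gs)\<leftarrow>ns. d * (\<Prod>g\<leftarrow>gs. g x))" for x
    by (induction ms) (auto simp: scaled ring_distribs)
  then have "(\<lambda>x\<in>X. f x * g x)
      = (\<lambda>x\<in>X. \<Sum>(d, gs)\<leftarrow>concat (map scaled ms). d * (\<Prod>g\<leftarrow>gs. g x))"
    by (intro restrict_ext) (simp add: mn)
  moreover have "\<forall>(c, fs)\<in>set (concat (map scaled ms)). set fs \<subseteq> S"
    using mn(1,2) by (fastforce simp: scaled_def)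
  ultimately show ?case by blast
qed

text \<open>Averaging is linear but not multiplicative, so a property of averages cannot be proved along the
  generation of an algebra by sums and products. It can be proved along linear combinations of
  monomials in the generators.\<close>

lemma function_algebra_monomial_induct [consumes 1, case_names monomial add]:
  assumes "f \<in> function_algebra X S"
    and monomial: "\<And>c fs. set fs \<subseteq> S \<Longrightarrow> P (\<lambda>x\<in>X. c * (\<Prod>g\<leftarrow>fs. g x))"
    and add: "\<And>f g. P f \<Longrightarrow> P g \<Longrightarrow> P (\<lambda>x\<in>X. f x + g x)"
  shows "P f"
proof -
  obtain ms where ms: "\<forall>(c, fs)\<in>set ms. set fs \<subseteq> S"
    and f: "f = (\<lambda>x\<in>X. \<Sum>(c, fs)\<leftarrow>ms. c * (\<Prod>g\<leftarrow>fs. g x))"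
    using function_algebra_monomials[OF assms(1)] by blast
  from ms have "P (\<lambda>x\<in>X. \<Sum>(c, fs)\<leftarrow>ms. c * (\<Prod>g\<leftarrow>fs. g x))"
  proof (induction ms)
    case Nil
    show ?case using monomial[of "[]" 0] by
      (simp only: set_simps empty_subsetI mult_zero_left list.map sum_list.Nil)
  next
    case (Cons t ms)
    obtain c fs where t: "t = (c, fs)" by (cases t)
    have "(\<lambda>x\<in>X. \<Sum>(c, fs)\<leftarrow>t # ms. c * (\<Prod>g\<leftarrow>fs. g x))
        = (\<lambda>x\<in>X. (\<lambda>x\<in>X. c * (\<Prod>g\<leftarrow>fs. g x)) x
          + (\<lambda>x\<in>X. \<Sum>(c, fs)\<leftarrow>ms. c * (\<Prod>g\<leftarrow>fs. g x)) x)"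
      by (rule restrict_ext) (simp add: t)
    moreover have "P \<dots>"
      using Cons by (intro add monomial) (auto simp: t)
    ultimately show ?case by (simp only:)
  qed
  then show ?thesis by (simp add: f)
qed

lemma function_algebra_prod_list:
  assumes "set fs \<subseteq> S"
  shows "(\<lambda>x\<in>X. \<Prod>f\<leftarrow>fs. f x) \<in> function_algebra X S"
  using assms
proof (induction fs)
  case Nil
  show ?case by (rule function_algebra_cong[OF function_algebra.const[where c = 1]]) simp
next
  case (Cons f fs)
  from Cons.prems have "f \<in> S" "set fs \<subseteq> S" by simp_all
  from function_algebra.mult[OF function_algebra.gen[OF this(1)] Cons.IH[OF this(2)]]
  show ?case by (rule function_algebra_cong) simp
qed

lemma rep_class_in_char_variety: "\<rho> \<in> rep_space Q \<Longrightarrow> rep_class Q \<rho> \<in> char_variety Q"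
  by (simp add: char_variety_def)

lemma conjugate_rep_closed:
  fixes Q :: "('a, 'b) affine_group_scheme"
  assumes "group Q" "a \<in> carrier Q" "\<rho> \<in> rep_space Q"
  shows "conjugate_rep Q a \<rho> \<in> rep_space Q"
proof -
  interpret group Q by (rule assms(1))
  show ?thesis using assms(2,3) by (simp add: conjugate_rep_def rep_space_def)
qed

text \<open>Invariance under conjugation is preserved by sums and products.\<close>

lemma coordinate_ring_closed:
  fixes Q :: "('a, 'b) affine_group_scheme" and S :: "(('n \<Rightarrow> 'a) set \<Rightarrow> complex) set"
  assumes "group Q" "S \<subseteq> coordinate_ring Q"
  shows "function_algebra (char_variety Q) S \<subseteq> coordinate_ring Q"
proof
  let ?R = "rep_space Q :: ('n \<Rightarrow> 'a) set" and ?V = "char_variety Q :: ('n \<Rightarrow> 'a) set set"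
  let ?pull = "\<lambda>f :: ('n \<Rightarrow> 'a) set \<Rightarrow> complex. \<lambda>\<rho>\<in>?R. f (rep_class Q \<rho>)"
  have ringI: "(\<lambda>x\<in>?V. f x) \<in> coordinate_ring Q"
    if "(\<lambda>\<rho>\<in>?R. f (rep_class Q \<rho>)) \<in> rep_functions Q"
      "\<And>a \<rho>. a \<in> carrier Q \<Longrightarrow> \<rho> \<in> ?R \<Longrightarrow>
        f (rep_class Q (conjugate_rep Q a \<rho>)) = f (rep_class Q \<rho>)" for f
  proof -
    have "?pull (\<lambda>x\<in>?V. f x) = (\<lambda>\<rho>\<in>?R. f (rep_class Q \<rho>))"
      by (rule restrict_ext) (simp add: rep_class_in_char_variety)
    then show ?thesis
      using that unfolding coordinate_ring_def invariants_def
      by (simp add: rep_class_in_char_variety conjugate_rep_closed[OF assms(1)])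
  qed
  have ringD: "?pull f \<in> rep_functions Q"
    "\<And>a \<rho>. a \<in> carrier Q \<Longrightarrow> \<rho> \<in> ?R \<Longrightarrow>
      f (rep_class Q (conjugate_rep Q a \<rho>)) = f (rep_class Q \<rho>)"
    if "f \<in> coordinate_ring Q" for f
    using that unfolding coordinate_ring_def invariants_def
    by (auto simp: conjugate_rep_closed[OF assms(1)])
  fix f assume "f \<in> function_algebra ?V S"
  then show "f \<in> coordinate_ring Q"
  proof (induction rule: function_algebra.induct)
    case (const c)
    have "(\<lambda>\<rho>\<in>?R. c) \<in> rep_functions Q"
      unfolding rep_functions_def by (rule function_algebra.const)
    then show ?case by (rule ringI[of "\<lambda>x. c"]) (rule refl)
  next
    case (gen f)
    then have f: "f \<in> coordinate_ring Q" using assms by blast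
    then have "f \<in> extensional ?V" by (simp add: coordinate_ring_def)
    from extensional_restrict[OF this] f show ?case by (simp only:)
  next
    case (add f g)
    from function_algebra.add[OF ringD(1)[OF add.IH(1), unfolded rep_functions_def]
        ringD(1)[OF add.IH(2), unfolded rep_functions_def]]
    have "(\<lambda>\<rho>\<in>?R. f (rep_class Q \<rho>) + g (rep_class Q \<rho>)) \<in> rep_functions Q"
      unfolding rep_functions_def by (rule function_algebra_cong) simp
    then show ?case
      by (rule ringI[of "\<lambda>x. f x + g x"]) (simp only: ringD(2)[OF add.IH(1)] ringD(2)[OF add.IH(2)])
  next
    case (mult f g)
    from function_algebra.mult[OF ringD(1)[OF mult.IH(1), unfolded rep_functions_def]
        ringD(1)[OF mult.IH(2), unfolded rep_functions_def]]
    have "(\<lambda>\<rho>\<in>?R. f (rep_class Q \<rho>) * g (rep_class Q \<rho>)) \<in> rep_functions Q"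
      unfolding rep_functions_def by (rule function_algebra_cong) simp
    then show ?case
      by (rule ringI[of "\<lambda>x. f x * g x"]) (simp only: ringD(2)[OF mult.IH(1)] ringD(2)[OF mult.IH(2)])
  qed
qed

section \<open>Quotients of affine groups by finite normal subgroups\<close>

text \<open>The translations by elements of \<open>H\<close> are required to be regular in order that the sum of a regular
  function over the cosets of \<open>H\<close> be a regular function on the quotient.\<close>

locale finite_quotient = normal H Q for H and Q :: "('a, 'b) affine_group_scheme" (structure) +
  fixes S :: "('a \<Rightarrow> complex) set"
  assumes finite_kernel: "finite H"
    and regular_eq: "regular Q = function_algebra (carrier Q) S"
    and regular_translate:
      "\<And>h p. h \<in> H \<Longrightarrow> p \<in> regular Q \<Longrightarrow> (\<lambda>a\<in>carrier Q. p (h \<otimes> a)) \<in> regular Q"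
begin

abbreviation "QH \<equiv> quotient_group Q H"

lemma group_QH: "group QH"
  using factorgroup_is_group
  by (simp add: group_def monoid_def group_axioms_def Units_def quotient_group_def)

definition proj :: "('n \<Rightarrow> 'a) \<Rightarrow> 'n \<Rightarrow> 'a set" where
  "proj \<rho> = (\<lambda>i. H #> \<rho> i)"

definition fibre :: "('n \<Rightarrow> 'a set) \<Rightarrow> ('n \<Rightarrow> 'a) set" where
  "fibre \<sigma> = (\<Pi>\<^sub>E i\<in>UNIV. \<sigma> i)"

lemma carrier_QH: "carrier QH = (\<lambda>a. H #> a) ` carrier Q"
  by (simp add: quotient_group_def carrier_FactGroup)

lemma coset_eqI: "a \<in> carrier Q \<Longrightarrow> b \<in> H #> a \<Longrightarrow> H #> b = H #> a"
  using repr_independence subgroup_axioms by blast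

lemma proj_in_rep_space: "\<rho> \<in> rep_space Q \<Longrightarrow> proj \<rho> \<in> rep_space QH"
  by (simp add: rep_space_def carrier_QH proj_def)

lemma rep_space_quotientE:
  fixes \<sigma> :: "'n \<Rightarrow> 'a set"
  assumes "\<sigma> \<in> rep_space QH"
  obtains \<rho> where "\<rho> \<in> rep_space Q" "\<sigma> = proj \<rho>"
proof -
  have "\<forall>i. \<exists>a. a \<in> carrier Q \<and> \<sigma> i = H #> a"
    using assms by (auto simp: rep_space_def carrier_QH)
  from choice[OF this] obtain \<rho> where \<rho>: "\<forall>i. \<rho> i \<in> carrier Q \<and> \<sigma> i = H #> \<rho> i" ..
  show ?thesis
  proof (rule that)
    show "\<rho> \<in> rep_space Q" using \<rho> by (simp add: rep_space_def)
    show "\<sigma> = proj \<rho>" using \<rho> by (simp add: proj_def fun_eq_iff)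
  qed
qed

lemma fibre_proj:
  assumes "\<rho> \<in> rep_space Q"
  shows "fibre (proj \<rho>) = {\<tau> \<in> rep_space Q. proj \<tau> = proj \<rho>}"
proof -
  have coset: "b \<in> H #> \<rho> i \<longleftrightarrow> b \<in> carrier Q \<and> H #> b = H #> \<rho> i" for b i
  proof
    have r: "\<rho> i \<in> carrier Q" using assms by (simp add: rep_space_def)
    {
      assume b: "b \<in> H #> \<rho> i"
      show "b \<in> carrier Q \<and> H #> b = H #> \<rho> i"
        using coset_eqI[OF r b] subsetD[OF r_coset_subset_G[OF subset r] b] by (rule conjI[rotated])
    next
      assume b: "b \<in> carrier Q \<and> H #> b = H #> \<rho> i"
      then have "b \<in> H #> b" by (intro rcos_self subgroup_axioms) (rule conjunct1)
      then show "b \<in> H #> \<rho> i" using b by (simp only:)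
    }
  qed
  show ?thesis
  proof (rule Set.set_eqI)
    fix \<tau>
    have "\<tau> \<in> fibre (proj \<rho>) \<longleftrightarrow> (\<forall>i. \<tau> i \<in> H #> \<rho> i)"
      by (simp add: fibre_def proj_def PiE_iff)
    also have "\<dots> \<longleftrightarrow> \<tau> \<in> {\<tau> \<in> rep_space Q. proj \<tau> = proj \<rho>}"
      unfolding coset by (simp add: rep_space_def proj_def fun_eq_iff all_conj_distrib)
    finally show "\<tau> \<in> fibre (proj \<rho>) \<longleftrightarrow> \<tau> \<in> {\<tau> \<in> rep_space Q. proj \<tau> = proj \<rho>}" .
  qed
qed

lemma fibre_in_rep_space:
  assumes "\<sigma> \<in> rep_space QH" "\<rho> \<in> fibre \<sigma>"
  shows "\<rho> \<in> rep_space Q"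
proof -
  obtain \<tau> where "\<tau> \<in> rep_space Q" "\<sigma> = proj \<tau>"
    by (rule rep_space_quotientE[OF assms(1)])
  with assms(2) fibre_proj[OF this(1)] show ?thesis by simp
qed

lemma finite_coset: "X \<in> carrier QH \<Longrightarrow> finite X"
  using finite_kernel by (auto simp: carrier_QH r_coset_def)

lemma card_fibre:
  fixes \<sigma> :: "'n::finite \<Rightarrow> 'a set"
  assumes "\<sigma> \<in> rep_space QH"
  shows "card (fibre \<sigma>) = card H ^ CARD('n)"
proof -
  have "card (\<sigma> i) = card H" for i
  proof (rule card_rcosets_equal[symmetric])
    show "\<sigma> i \<in> rcosets H"
      using assms by (auto simp: rep_space_def carrier_QH RCOSETS_def)
    show "H \<subseteq> carrier Q" by (rule subset)
  qed
  then show ?thesis unfolding fibre_def by (simp add: card_PiE)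
qed

lemma card_kernel_pos: "card H > 0"
proof -
  have "H \<noteq> {}" using subgroup.one_closed[OF subgroup_axioms] by blast
  then show ?thesis by (simp add: card_gt_0_iff finite_kernel)
qed

text \<open>As a function of \<open>a\<close>, the sum of \<open>p\<close> over the coset of \<open>a\<close> is the sum of the translates of \<open>p\<close> by the
  elements of \<open>H\<close>.\<close>

lemma coset_sum_regular:
  assumes "p \<in> regular Q"
  shows "(\<lambda>X\<in>carrier QH. \<Sum>a\<in>X. p a) \<in> regular QH"
proof -
  have sum: "(\<Sum>b\<in>H #> a. p b) = (\<Sum>h\<in>H. p (h \<otimes> a))" if "a \<in> carrier Q" for a
  proof -
    have "H #> a = (\<lambda>h. h \<otimes> a) ` H" by (auto simp: r_coset_def)
    moreover have "inj_on (\<lambda>h. h \<otimes> a) H" by (rule inj_on_g[OF subset that])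
    ultimately show ?thesis by (simp add: sum.reindex)
  qed
  have "(\<lambda>a\<in>carrier Q. \<Sum>h\<in>H. p (h \<otimes> a)) \<in> regular Q"
    unfolding regular_eq
    by (rule function_algebra_sum[OF finite_kernel])
      (rule regular_translate[unfolded regular_eq, OF _ assms[unfolded regular_eq]])
  then have "(\<lambda>a\<in>carrier Q. (\<lambda>X\<in>carrier QH. \<Sum>a\<in>X. p a) (H #> a)) \<in> regular Q"
    unfolding regular_eq by (rule function_algebra_cong) (simp add: carrier_QH sum)
  then show ?thesis by (simp add: quotient_group_def)
qed

text \<open>Grouping the factors by coordinate separates the variables.\<close>

lemma monomial_eq_prod:
  fixes fs :: "(('n::finite \<Rightarrow> 'a) \<Rightarrow> complex) list"
  assumes "set fs \<subseteq> {\<lambda>\<rho>. f (\<rho> i) | f i. f \<in> regular Q}"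
  shows "\<exists>p. (\<forall>i. p i \<in> regular Q) \<and> (\<forall>\<rho>\<in>rep_space Q. (\<Prod>g\<leftarrow>fs. g \<rho>) = (\<Prod>i\<in>UNIV. p i (\<rho> i)))"
  using assms
proof (induction fs)
  case Nil
  show ?case
  proof (intro exI conjI allI ballI)
    show "(\<lambda>a\<in>carrier Q. 1) \<in> regular Q" for i :: 'n
      unfolding regular_eq by (rule function_algebra.const)
  qed (simp add: rep_space_def)
next
  case (Cons g fs)
  then have "set fs \<subseteq> {\<lambda>\<rho>. f (\<rho> i) | f i. f \<in> regular Q}" by simp
  from Cons.IH[OF this] obtain p where "(\<forall>i. p i \<in> regular Q) \<and>
    (\<forall>\<rho>\<in>rep_space Q. (\<Prod>g\<leftarrow>fs. g \<rho>) = (\<Prod>i\<in>UNIV. p i (\<rho> i)))" ..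
  then have p: "\<And>i. p i \<in> regular Q"
    "\<And>\<rho>. \<rho> \<in> rep_space Q \<Longrightarrow> (\<Prod>g\<leftarrow>fs. g \<rho>) = (\<Prod>i\<in>UNIV. p i (\<rho> i))"
    by simp_all
  obtain f j where g: "g = (\<lambda>\<rho>. f (\<rho> j))" and f: "f \<in> regular Q" using Cons.prems by auto
  define q where "q = p(j := \<lambda>a\<in>carrier Q. f a * p j a)"
  have "q i \<in> regular Q" for i
  proof (cases "i = j")
    case True
    from function_algebra.mult[OF f[unfolded regular_eq] p(1)[of j, unfolded regular_eq]]
    show ?thesis unfolding True q_def fun_upd_same regular_eq .
  qed (simp add: q_def p(1))
  moreover have "(\<Prod>g\<leftarrow>g # fs. g \<rho>) = (\<Prod>i\<in>UNIV. q i (\<rho> i))" if \<rho>: "\<rho> \<in> rep_space Q" for \<rho>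
  proof -
    have "(\<Prod>i\<in>UNIV. q i (\<rho> i)) = q j (\<rho> j) * (\<Prod>i\<in>UNIV - {j}. q i (\<rho> i))"
      by (rule prod.remove) simp_all
    also have "(\<Prod>i\<in>UNIV - {j}. q i (\<rho> i)) = (\<Prod>i\<in>UNIV - {j}. p i (\<rho> i))"
      by (rule prod.cong) (simp_all add: q_def)
    also have "q j (\<rho> j) = f (\<rho> j) * p j (\<rho> j)"
      using \<rho> by (simp add: q_def rep_space_def)
    also have "\<dots> * (\<Prod>i\<in>UNIV - {j}. p i (\<rho> i))
        = f (\<rho> j) * (p j (\<rho> j) * (\<Prod>i\<in>UNIV - {j}. p i (\<rho> i)))"
      by (rule mult.assoc)
    also have "p j (\<rho> j) * (\<Prod>i\<in>UNIV - {j}. p i (\<rho> i)) = (\<Prod>i\<in>UNIV. p i (\<rho> i))"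
      by (rule prod.remove[symmetric]) auto
    finally show ?thesis using p(2)[OF \<rho>] by (simp add: g)
  qed
  ultimately show ?case by (intro exI[of _ q] conjI allI ballI)
qed

text \<open>An invariant of \<open>H\<^sup>N\<close> in the tensor product of \<open>N\<close> copies of \<open>\<complex>[Q]\<close> lies in the tensor product of
  the invariants of \<open>H\<close>. On a product of functions of single coordinates the fibre sum is the
  product of the coset sums, because the fibre is the product of the cosets.\<close>

lemma fibre_sum_in_rep_functions:
  fixes F :: "('n::finite \<Rightarrow> 'a) \<Rightarrow> complex"
  assumes "F \<in> rep_functions Q"
  shows "(\<lambda>\<sigma>\<in>rep_space QH. \<Sum>\<rho>\<in>fibre \<sigma>. F \<rho>) \<in> rep_functions QH"
  using assms unfolding rep_functions_def[of Q]
proof (induction rule: function_algebra_monomial_induct)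
  case (monomial c fs)
  then obtain p where p: "\<And>i. p i \<in> regular Q"
    "\<And>\<rho>. \<rho> \<in> rep_space Q \<Longrightarrow> (\<Prod>g\<leftarrow>fs. g \<rho>) = (\<Prod>i\<in>UNIV. p i (\<rho> i))"
    using monomial_eq_prod by blast
  define s where "s i = (\<lambda>X\<in>carrier QH. \<Sum>a\<in>X. p i a)" for i
  have "restrict (\<lambda>\<sigma>. s i (\<sigma> i)) (rep_space QH) \<in> rep_functions QH" for i
  proof -
    have "s i \<in> regular QH" unfolding s_def by (rule coset_sum_regular[OF p(1)])
    then show ?thesis unfolding rep_functions_def by (intro function_algebra.gen) blast
  qed
  then have "(\<lambda>\<sigma>\<in>rep_space QH. \<Prod>i\<in>UNIV. s i (\<sigma> i)) \<in> rep_functions QH"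
    unfolding rep_functions_def by (intro function_algebra_prod) auto
  from function_algebra.mult[OF function_algebra.const[where c = c] this[unfolded rep_functions_def]]
  show ?case unfolding rep_functions_def
  proof (rule function_algebra_cong)
    fix \<sigma> :: "'n \<Rightarrow> 'a set" assume \<sigma>: "\<sigma> \<in> rep_space QH"
    have fin: "finite (\<sigma> i)" for i
      using \<sigma> finite_coset by (auto simp: rep_space_def)
    have "(\<Prod>i\<in>UNIV. s i (\<sigma> i)) = (\<Prod>i\<in>UNIV. \<Sum>a\<in>\<sigma> i. p i a)"
      using \<sigma> by (simp add: s_def rep_space_def)
    also have "\<dots> = (\<Sum>\<rho>\<in>fibre \<sigma>. \<Prod>i\<in>UNIV. p i (\<rho> i))"
      unfolding fibre_def by (rule prod_sum_PiE) (auto simp: fin)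
    also have "\<dots> = (\<Sum>\<rho>\<in>fibre \<sigma>. \<Prod>g\<leftarrow>fs. g \<rho>)"
      using p(2) fibre_in_rep_space[OF \<sigma>] by (intro sum.cong) auto
    finally show "(\<Sum>\<rho>\<in>fibre \<sigma>. (\<lambda>\<rho>\<in>rep_space Q. c * (\<Prod>g\<leftarrow>fs. g \<rho>)) \<rho>)
        = (\<lambda>\<sigma>\<in>rep_space QH. (\<lambda>\<sigma>\<in>rep_space QH. c) \<sigma> *
            (\<lambda>\<sigma>\<in>rep_space QH. \<Prod>i\<in>UNIV. s i (\<sigma> i)) \<sigma>) \<sigma>"
      using \<sigma> fibre_in_rep_space[OF \<sigma>] by (simp add: sum_distrib_left)
  qed
  next
  case (add F F')
  from function_algebra.add[OF add[unfolded rep_functions_def]]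
  show ?case unfolding rep_functions_def
  proof (rule function_algebra_cong)
    fix \<sigma> :: "'n \<Rightarrow> 'a set" assume \<sigma>: "\<sigma> \<in> rep_space QH"
    have "(\<Sum>\<rho>\<in>fibre \<sigma>. (\<lambda>\<rho>\<in>rep_space Q. F \<rho> + F' \<rho>) \<rho>) = (\<Sum>\<rho>\<in>fibre \<sigma>. F \<rho> + F' \<rho>)"
      by (rule sum.cong) (simp_all add: fibre_in_rep_space[OF \<sigma>])
    then show "(\<Sum>\<rho>\<in>fibre \<sigma>. (\<lambda>\<rho>\<in>rep_space Q. F \<rho> + F' \<rho>) \<rho>)
        = (\<lambda>\<sigma>\<in>rep_space QH. (\<lambda>\<sigma>\<in>rep_space QH. \<Sum>\<rho>\<in>fibre \<sigma>. F \<rho>) \<sigma> +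
            (\<lambda>\<sigma>\<in>rep_space QH. \<Sum>\<rho>\<in>fibre \<sigma>. F' \<rho>) \<sigma>) \<sigma>"
      using \<sigma> by (simp add: sum.distrib)
  qed
qed

lemma proj_conjugate_rep:
  assumes a: "a \<in> carrier Q" and \<rho>: "\<rho> \<in> rep_space Q"
  shows "conjugate_rep QH (H #> a) (proj \<rho>) = proj (conjugate_rep Q a \<rho>)"
proof -
  have "inv\<^bsub>QH\<^esub> (H #> a) = inv\<^bsub>Q Mod H\<^esub> (H #> a)"
    by (simp add: m_inv_def quotient_group_def)
  also have "\<dots> = H #> inv a"
    using a by (simp add: inv_FactGroup rcos_inv carrier_FactGroup)
  finally show ?thesis
    using a \<rho> by (simp add: conjugate_rep_def proj_def quotient_group_def rcos_sum rep_space_def)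
qed

text \<open>A function that is constant on the fibres is its own fibre average, and the descended function is
  conjugation invariant because \<open>proj\<close> is surjective and respects conjugation.\<close>

lemma invariants_descend:
  fixes F :: "('n::finite \<Rightarrow> 'a) \<Rightarrow> complex"
  assumes F: "F \<in> invariants Q"
    and const: "\<And>\<rho> \<tau>. \<rho> \<in> rep_space Q \<Longrightarrow> \<tau> \<in> rep_space Q \<Longrightarrow> proj \<tau> = proj \<rho> \<Longrightarrow> F \<tau> = F \<rho>"
  shows "\<exists>L\<in>invariants QH. \<forall>\<rho>\<in>rep_space Q. L (proj \<rho>) = F \<rho>"
proof -
  define n :: complex where "n = of_nat (card H ^ CARD('n))"
  have n: "n \<noteq> 0" unfolding n_def using card_kernel_pos by simp
  define L where "L = (\<lambda>\<sigma>\<in>rep_space QH. (\<lambda>\<sigma>\<in>rep_space QH. inverse n) \<sigma> *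
    (\<lambda>\<sigma>\<in>rep_space QH. \<Sum>\<rho>\<in>fibre \<sigma>. F \<rho>) \<sigma>)"
  have L_proj: "L (proj \<rho>) = F \<rho>" if \<rho>: "\<rho> \<in> rep_space Q" for \<rho>
  proof -
    have "(\<Sum>\<tau>\<in>fibre (proj \<rho>). F \<tau>) = (\<Sum>\<tau>\<in>fibre (proj \<rho>). F \<rho>)"
      using const[OF \<rho>] by (intro sum.cong) (auto simp: fibre_proj[OF \<rho>])
    also have "\<dots> = n * F \<rho>"
      by (simp add: card_fibre[OF proj_in_rep_space[OF \<rho>]] n_def)
    finally show ?thesis using proj_in_rep_space[OF \<rho>] n by (simp add: L_def)
  qed
  have "F \<in> rep_functions Q" using F by (simp add: invariants_def)
  from function_algebra.mult[OF function_algebra.const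
      fibre_sum_in_rep_functions[OF this, unfolded rep_functions_def]]
  have "L \<in> rep_functions QH" unfolding rep_functions_def L_def .
  moreover have "L (conjugate_rep QH x \<sigma>) = L \<sigma>"
    if x: "x \<in> carrier QH" and \<sigma>: "\<sigma> \<in> rep_space QH" for x and \<sigma> :: "'n \<Rightarrow> 'a set"
  proof -
    obtain a where a: "a \<in> carrier Q" "x = H #> a" using x by (auto simp: carrier_QH)
    obtain \<rho> where \<rho>: "\<rho> \<in> rep_space Q" "\<sigma> = proj \<rho>" using \<sigma> by (rule rep_space_quotientE)
    have "conjugate_rep Q a \<rho> \<in> rep_space Q" by (rule conjugate_rep_closed[OF is_group a(1) \<rho>(1)])
    then show ?thesis
      using F a \<rho> by (simp add: proj_conjugate_rep L_proj invariants_def)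
  qed
  ultimately have "L \<in> invariants QH" by (simp add: invariants_def)
  with L_proj show ?thesis by (intro bexI[of _ L] ballI)
qed


lemma induced_map_proj:
  "\<rho> \<in> rep_space Q \<Longrightarrow> induced_map Q H (rep_class Q \<rho>) = rep_class QH (proj \<rho>)"
  using induced_map_rep_class[OF normal_axioms] by (simp add: proj_def)

lemma char_variety_quotientE:
  fixes y :: "('n \<Rightarrow> 'a set) set"
  assumes "y \<in> char_variety QH"
  obtains \<rho> where "\<rho> \<in> rep_space Q" "y = rep_class QH (proj \<rho>)"
  using assms by (auto simp: char_variety_def elim: rep_space_quotientE)

text \<open>Uniqueness holds because the induced map of character varieties is surjective.\<close>

lemma coordinate_ring_descend:
  fixes F :: "('n::finite \<Rightarrow> 'a) set \<Rightarrow> complex"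
  assumes F: "F \<in> coordinate_ring Q"
    and const: "\<And>\<rho> \<tau>. \<rho> \<in> rep_space Q \<Longrightarrow> \<tau> \<in> rep_space Q \<Longrightarrow> proj \<tau> = proj \<rho> \<Longrightarrow>
      F (rep_class Q \<tau>) = F (rep_class Q \<rho>)"
  shows "\<exists>!l. l \<in> coordinate_ring QH \<and> (\<forall>x\<in>char_variety Q. F x = l (induced_map Q H x))"
proof (rule ex_ex1I)
  let ?F = "\<lambda>\<rho>\<in>rep_space Q. F (rep_class Q \<rho>)"
  have inv: "?F \<in> invariants Q"
    using F by (simp add: coordinate_ring_def)
  have fibre_const: "?F \<tau> = ?F \<rho>"
    if "\<rho> \<in> rep_space Q" "\<tau> \<in> rep_space Q" "proj \<tau> = proj \<rho>" for \<rho> \<tau>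
    using const[OF that] that(1,2) by simp
  from invariants_descend[OF inv fibre_const] obtain L
    where "L \<in> invariants QH" "\<forall>\<rho>\<in>rep_space Q. L (proj \<rho>) = ?F \<rho>" ..
  note L = this(1) bspec[OF this(2)]
  from L(1) obtain l where l: "l \<in> coordinate_ring QH"
    "L = (\<lambda>\<sigma>\<in>rep_space QH. l (rep_class QH \<sigma>))"
    using bij_betw_imp_surj_on[OF bij_betw_coordinate_ring[where Q = QH]] by blast
  have "F (rep_class Q \<rho>) = l (induced_map Q H (rep_class Q \<rho>))" if "\<rho> \<in> rep_space Q" for \<rho>
    using L(2)[OF that] that by (simp add: l(2) induced_map_proj proj_in_rep_space)
  with l(1) show "\<exists>l. l \<in> coordinate_ring QH \<and> (\<forall>x\<in>char_variety Q. F x = l (induced_map Q H x))"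
    by (auto simp: char_variety_def)
next
  fix l l' :: "('n \<Rightarrow> 'a set) set \<Rightarrow> complex"
  assume l: "l \<in> coordinate_ring QH \<and> (\<forall>x\<in>char_variety Q. F x = l (induced_map Q H x))"
    and l': "l' \<in> coordinate_ring QH \<and> (\<forall>x\<in>char_variety Q. F x = l' (induced_map Q H x))"
  show "l = l'"
  proof (rule extensionalityI)
    show "l \<in> extensional (char_variety QH)" "l' \<in> extensional (char_variety QH)"
      using l l' by (simp_all add: coordinate_ring_def)
    fix y :: "('n \<Rightarrow> 'a set) set" assume "y \<in> char_variety QH"
    then obtain \<rho> where \<rho>: "\<rho> \<in> rep_space Q" "y = rep_class QH (proj \<rho>)"
      by (rule char_variety_quotientE)
    then show "l y = l' y"
      using l l' rep_class_in_char_variety[OF \<rho>(1)] by (metis induced_map_proj)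
  qed
qed

text \<open>The dichotomy for monomials is the one that eigenfunctions of \<open>H\<^sup>N\<close> satisfy: trivial character or
  vanishing fibre sums. Write the pullback of a function from the quotient as a linear combination
  of monomials. It equals its fibre average, to which only the descending monomials contribute.\<close>

lemma coordinate_ring_quotient_generated:
  fixes T :: "(('n::finite \<Rightarrow> 'a) set \<Rightarrow> complex) set"
  assumes T: "coordinate_ring Q \<subseteq> function_algebra (char_variety Q) T"
    and M: "M \<subseteq> coordinate_ring QH"
    and monomial: "\<And>fs. set fs \<subseteq> T \<Longrightarrow> fs \<noteq> [] \<Longrightarrow>
      (\<exists>l\<in>M. \<forall>\<rho>\<in>rep_space Q. (\<Prod>f\<leftarrow>fs. f (rep_class Q \<rho>)) = l (rep_class QH (proj \<rho>))) \<or>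
      (\<forall>\<sigma>\<in>rep_space QH. (\<Sum>\<rho>\<in>fibre \<sigma>. \<Prod>f\<leftarrow>fs. f (rep_class Q \<rho>)) = 0)"
  shows "function_algebra (char_variety QH) M = coordinate_ring QH"
proof (rule antisym[OF coordinate_ring_closed[OF group_QH M]], rule subsetI)
  let ?V = "char_variety Q :: ('n \<Rightarrow> 'a) set set"
  let ?W = "char_variety QH :: ('n \<Rightarrow> 'a set) set set"
  define n :: complex where "n = of_nat (card H ^ CARD('n))"
  have n: "n \<noteq> 0" unfolding n_def using card_kernel_pos by simp
  have fibre_const: "(\<Sum>\<tau>\<in>fibre (proj \<rho>). l (rep_class QH (proj \<tau>))) = n * l (rep_class QH (proj \<rho>))"
    if \<rho>: "\<rho> \<in> rep_space Q" for \<rho> :: "'n \<Rightarrow> 'a" and l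
  proof -
    have "(\<Sum>\<tau>\<in>fibre (proj \<rho>). l (rep_class QH (proj \<tau>)))
        = (\<Sum>\<tau>\<in>fibre (proj \<rho>). l (rep_class QH (proj \<rho>)))"
      by (intro sum.cong) (auto simp: fibre_proj[OF \<rho>])
    then show ?thesis by (simp add: card_fibre[OF proj_in_rep_space[OF \<rho>]] n_def)
  qed
  \<comment> \<open>fibre sums of linear combinations of monomials in \<open>T\<close> come from the algebra generated by \<open>M\<close>\<close>
  have averaged: "\<exists>L\<in>function_algebra ?W M. \<forall>\<rho>\<in>rep_space Q.
      (\<Sum>\<tau>\<in>fibre (proj \<rho>). F (rep_class Q \<tau>)) = L (rep_class QH (proj \<rho>))"
    if "F \<in> function_algebra ?V T" for F
    using that
  proof (induction rule: function_algebra_monomial_induct)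
    case (monomial c fs)
    let ?F = "\<lambda>x\<in>?V. c * (\<Prod>f\<leftarrow>fs. f x)"
    have F_sum: "(\<Sum>\<tau>\<in>fibre (proj \<rho>). ?F (rep_class Q \<tau>))
        = c * (\<Sum>\<tau>\<in>fibre (proj \<rho>). \<Prod>f\<leftarrow>fs. f (rep_class Q \<tau>))"
      if \<rho>: "\<rho> \<in> rep_space Q" for \<rho>
      unfolding sum_distrib_left
      by (intro sum.cong) (auto simp: fibre_proj[OF \<rho>] rep_class_in_char_variety)
    consider (trivial) "fs = []"
      | (descends) l where "l \<in> M"
          "\<And>\<rho>. \<rho> \<in> rep_space Q \<Longrightarrow> (\<Prod>f\<leftarrow>fs. f (rep_class Q \<rho>)) = l (rep_class QH (proj \<rho>))"
      | (cancels) "\<And>\<sigma>. \<sigma> \<in> rep_space QH \<Longrightarrow> (\<Sum>\<rho>\<in>fibre \<sigma>. \<Prod>f\<leftarrow>fs. f (rep_class Q \<rho>)) = 0"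
      using monomial assms(3) by blast
    then show ?case
    proof cases
      case trivial
      have "(\<Sum>\<tau>\<in>fibre (proj \<rho>). ?F (rep_class Q \<tau>)) = (\<lambda>x\<in>?W. c * n) (rep_class QH (proj \<rho>))"
        if \<rho>: "\<rho> \<in> rep_space Q" for \<rho>
        unfolding F_sum[OF \<rho>] using fibre_const[OF \<rho>, of "\<lambda>x. 1"] \<rho>
        by (simp add: trivial rep_class_in_char_variety proj_in_rep_space)
      then show ?thesis by (intro bexI[OF _ function_algebra.const]) blast
    next
      case descends
      let ?L = "\<lambda>x\<in>?W. (\<lambda>x\<in>?W. c * n) x * restrict l ?W x"
      have "(\<Sum>\<tau>\<in>fibre (proj \<rho>). ?F (rep_class Q \<tau>)) = ?L (rep_class QH (proj \<rho>))"
        if \<rho>: "\<rho> \<in> rep_space Q" for \<rho>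
      proof -
        have "(\<Sum>\<tau>\<in>fibre (proj \<rho>). \<Prod>f\<leftarrow>fs. f (rep_class Q \<tau>))
            = (\<Sum>\<tau>\<in>fibre (proj \<rho>). l (rep_class QH (proj \<tau>)))"
          using descends(2) by (intro sum.cong) (auto simp: fibre_proj[OF \<rho>])
        then show ?thesis unfolding F_sum[OF \<rho>] using fibre_const[OF \<rho>, of l] \<rho>
          by (simp add: rep_class_in_char_variety proj_in_rep_space)
      qed
      then show ?thesis
        by (intro bexI[OF _ function_algebra.mult[OF function_algebra.const
              function_algebra.gen[OF descends(1)]]]) blast
    next
      case cancels
      have "(\<Sum>\<tau>\<in>fibre (proj \<rho>). ?F (rep_class Q \<tau>)) = (\<lambda>x\<in>?W. 0) (rep_class QH (proj \<rho>))"
        if \<rho>: "\<rho> \<in> rep_space Q" for \<rho>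
        unfolding F_sum[OF \<rho>] using cancels[OF proj_in_rep_space[OF \<rho>]] \<rho>
        by (simp add: rep_class_in_char_variety proj_in_rep_space)
      then show ?thesis by (intro bexI[OF _ function_algebra.const]) blast
    qed
  next
    case (add F F')
    then obtain L L' where L: "L \<in> function_algebra ?W M" "L' \<in> function_algebra ?W M"
      "\<And>\<rho>. \<rho> \<in> rep_space Q \<Longrightarrow>
        (\<Sum>\<tau>\<in>fibre (proj \<rho>). F (rep_class Q \<tau>)) = L (rep_class QH (proj \<rho>))"
      "\<And>\<rho>. \<rho> \<in> rep_space Q \<Longrightarrow>
        (\<Sum>\<tau>\<in>fibre (proj \<rho>). F' (rep_class Q \<tau>)) = L' (rep_class QH (proj \<rho>))"
      by blast
    have "(\<Sum>\<tau>\<in>fibre (proj \<rho>). (\<lambda>x\<in>?V. F x + F' x) (rep_class Q \<tau>))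
        = (\<lambda>x\<in>?W. L x + L' x) (rep_class QH (proj \<rho>))" if \<rho>: "\<rho> \<in> rep_space Q" for \<rho>
    proof -
      have "(\<Sum>\<tau>\<in>fibre (proj \<rho>). (\<lambda>x\<in>?V. F x + F' x) (rep_class Q \<tau>))
          = (\<Sum>\<tau>\<in>fibre (proj \<rho>). F (rep_class Q \<tau>) + F' (rep_class Q \<tau>))"
        by (intro sum.cong) (auto simp: fibre_proj[OF \<rho>] rep_class_in_char_variety)
      then show ?thesis
        by (simp add: sum.distrib L \<rho> rep_class_in_char_variety proj_in_rep_space)
    qed
    then show ?case by (intro bexI[OF _ function_algebra.add[OF L(1,2)]]) blast
  qed
  fix f :: "('n \<Rightarrow> 'a set) set \<Rightarrow> complex"
  assume f: "f \<in> coordinate_ring QH"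
  \<comment> \<open>the pullback of \<open>f\<close>, whose fibre sums are \<open>|H|\<^sup>N\<close> times \<open>f\<close>\<close>
  define F where "F = (\<lambda>x\<in>?V. f (induced_map Q H x))"
  have F: "F (rep_class Q \<rho>) = f (rep_class QH (proj \<rho>))" if "\<rho> \<in> rep_space Q" for \<rho>
    using that by (simp add: F_def rep_class_in_char_variety induced_map_proj)
  have "(\<lambda>\<rho>\<in>rep_space Q. F (rep_class Q \<rho>)) \<in> invariants Q"
  proof -
    have "(\<lambda>\<sigma>\<in>rep_space QH. f (rep_class QH \<sigma>)) \<in> invariants QH"
      using f by (simp add: coordinate_ring_def)
    from invariants_pullback[OF normal_axioms this]
    have "(\<lambda>\<rho>\<in>rep_space Q. (\<lambda>\<sigma>\<in>rep_space QH. f (rep_class QH \<sigma>)) (proj \<rho>)) \<in> invariants Q"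
      by (simp only: proj_def)
    moreover have "(\<lambda>\<rho>\<in>rep_space Q. (\<lambda>\<sigma>\<in>rep_space QH. f (rep_class QH \<sigma>)) (proj \<rho>))
        = (\<lambda>\<rho>\<in>rep_space Q. F (rep_class Q \<rho>))"
      by (rule restrict_ext) (simp add: F proj_in_rep_space)
    ultimately show ?thesis by (simp only:)
  qed
  then have "F \<in> coordinate_ring Q" unfolding coordinate_ring_def by (simp add: F_def)
  then obtain L where L: "L \<in> function_algebra ?W M"
    "\<And>\<rho>. \<rho> \<in> rep_space Q \<Longrightarrow>
      (\<Sum>\<tau>\<in>fibre (proj \<rho>). F (rep_class Q \<tau>)) = L (rep_class QH (proj \<rho>))"
    using averaged T by blast
  have "restrict f ?W \<in> function_algebra ?W M"
  proof (rule function_algebra_cong[OF function_algebra.mult[OF function_algebra.const L(1)]])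
    fix y assume y: "y \<in> ?W"
    then obtain \<rho> where \<rho>: "\<rho> \<in> rep_space Q" "y = rep_class QH (proj \<rho>)"
      by (rule char_variety_quotientE)
    have "L y = (\<Sum>\<tau>\<in>fibre (proj \<rho>). f (rep_class QH (proj \<tau>)))"
      unfolding \<rho>(2) L(2)[OF \<rho>(1), symmetric]
      by (intro sum.cong) (auto simp: fibre_proj[OF \<rho>(1)] F)
    then show "f y = (\<lambda>y\<in>?W. (\<lambda>y\<in>?W. inverse n) y * L y) y"
      using y n by (simp add: fibre_const[OF \<rho>(1)] \<rho>(2)[symmetric])
  qed
  moreover have "restrict f ?W = f"
    using f by (simp add: coordinate_ring_def extensional_restrict)
  ultimately show "f \<in> function_algebra ?W M" by (simp only:)
qed

end

section \<open>Scalar matrices\<close>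

lemma mat_mult_entry:
  fixes A :: "'a::semiring_1^'d^'d"
  shows "(mat c ** A) $ i $ j = c * A $ i $ j"
  by (simp add: matrix_matrix_mult_def mat_def if_distrib[of "\<lambda>x. x * _"] sum.delta cong: if_cong)

lemma mult_mat_entry:
  fixes A :: "'a::semiring_1^'d^'d"
  shows "(A ** mat c) $ i $ j = A $ i $ j * c"
  by (simp add: matrix_matrix_mult_def mat_def if_distrib[of "\<lambda>x. _ * x"] sum.delta cong: if_cong)

lemma mat_mult_commute:
  fixes A :: "'a::comm_semiring_1^'d^'d"
  shows "A ** mat c = mat c ** A"
  by (simp add: vec_eq_iff mat_mult_entry mult_mat_entry mult.commute)

lemma mat_mult_mat: "(mat a :: 'a::semiring_1^'d^'d) ** mat b = mat (a * b)"
  by (simp add: vec_eq_iff mat_mult_entry) (simp add: mat_def)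

lemma mat_eq_iff: "(mat a :: 'a::zero^'d^'d) = mat b \<longleftrightarrow> a = b"
  by (auto simp: vec_eq_iff mat_def)

lemma trace_mat_mult:
  fixes A :: "'a::semiring_1^'d^'d"
  shows "trace (mat c ** A) = c * trace A"
  by (simp add: trace_def mat_mult_entry sum_distrib_left)

definition exponent_sum :: "'n word \<Rightarrow> 'n \<Rightarrow> int" where
  "exponent_sum g i = (\<Sum>(j, b)\<leftarrow>g. if j = i then (if b then 1 else - 1) else 0)"

lemma exponent_sum_Cons:
  "exponent_sum ((j, b) # g) i = (if j = i then (if b then 1 else - 1) else 0) + exponent_sum g i"
  by (simp add: exponent_sum_def)

lemma sum_exponent_vector_mod:
  "(\<Sum>g\<leftarrow>gs. exponent_vector m g i) mod int m = (\<Sum>g\<leftarrow>gs. exponent_sum g i) mod int m"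
proof (induction gs)
  case (Cons g gs)
  have "(\<Sum>g\<leftarrow>g # gs. exponent_vector m g i) mod int m
      = (exponent_sum g i mod int m + (\<Sum>g\<leftarrow>gs. exponent_vector m g i) mod int m) mod int m"
    by (simp add: exponent_vector_def exponent_sum_def mod_simps)
  then show ?case unfolding Cons.IH by (simp add: mod_simps)
qed simp

text \<open>The scalar by which \<open>\<rho>(g)\<close> is multiplied when each \<open>\<rho>\<^sub>i\<close> is multiplied by \<open>c\<^sub>i\<close>.\<close>

definition word_weight :: "('n::finite \<Rightarrow> complex) \<Rightarrow> 'n word \<Rightarrow> complex" where
  "word_weight c g = (\<Prod>i\<in>UNIV. c i powi exponent_sum g i)"

lemma word_weight_Nil: "word_weight c [] = 1"
  by (simp add: word_weight_def exponent_sum_def)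

lemma word_weight_Cons:
  assumes "\<And>i. c i \<noteq> 0"
  shows "word_weight c ((j, b) # g) = (if b then c j else inverse (c j)) * word_weight c g"
proof -
  have "c i powi exponent_sum ((j, b) # g) i
      = (if i = j then (if b then c j else inverse (c j)) else 1) * c i powi exponent_sum g i" for i
    using assms[of i] by (auto simp: exponent_sum_Cons power_int_add power_int_minus)
  then show ?thesis by (simp add: word_weight_def prod.distrib prod.delta)
qed

lemma prod_word_weight:
  assumes "\<And>i. c i \<noteq> 0"
  shows "(\<Prod>g\<leftarrow>gs. word_weight c g) = (\<Prod>i\<in>UNIV. c i powi (\<Sum>g\<leftarrow>gs. exponent_sum g i))"
  by (induction gs) (simp_all add: word_weight_def power_int_add assms prod.distrib[symmetric])

section \<open>Quotients by finite groups of scalar matrices\<close>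

locale scalar_subgroup =
  fixes G H :: "(complex^'d^'d) set"
  assumes subgroup_G: "subgroup G general_linear"
    and subgroup_H: "subgroup H (matrix_group G)"
    and finite_H: "finite H"
    and scalar_H: "\<And>A. A \<in> H \<Longrightarrow> \<exists>c. A = mat c"
begin

abbreviation "Q \<equiv> matrix_group G"

lemma Q_simps [simp]: "carrier Q = G" "x \<otimes>\<^bsub>Q\<^esub> y = x ** y" "\<one>\<^bsub>Q\<^esub> = mat 1"
  by (simp_all add: matrix_group_def)

lemma group_Q: "group Q"
  by (rule group_matrix_group[OF subgroup_G])

lemma H_subset_G: "H \<subseteq> G"
  using subgroup.subset[OF subgroup_H] by simp

definition scalars :: "complex set" where
  "scalars = {c. mat c \<in> H}"

lemma H_eq: "H = mat ` scalars"
  using scalar_H by (auto simp: scalars_def)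

lemma inj_on_mat: "inj_on (mat :: complex \<Rightarrow> complex^'d^'d) scalars"
  by (simp add: inj_on_def mat_eq_iff)

lemma card_scalars: "card scalars = card H"
  using card_image[OF inj_on_mat] by (simp only: H_eq[symmetric])

lemma finite_scalars: "finite scalars"
  using finite_image_iff[OF inj_on_mat] finite_H by (simp only: H_eq[symmetric])

lemma one_scalars: "1 \<in> scalars"
  using subgroup.one_closed[OF subgroup_H] by (simp add: scalars_def)

lemma mult_scalars: "c \<in> scalars \<Longrightarrow> d \<in> scalars \<Longrightarrow> c * d \<in> scalars"
  using subgroup.m_closed[OF subgroup_H] by (simp add: scalars_def flip: mat_mult_mat)

lemma mat_mult_G: "c \<in> scalars \<Longrightarrow> A \<in> G \<Longrightarrow> mat c ** A \<in> G"
  using monoid.m_closed[OF group.is_monoid[OF group_Q], of "mat c" A] H_subset_G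
  by (auto simp: scalars_def)

lemma inverse_scalars:
  assumes "c \<in> scalars"
  shows "c \<noteq> 0" "inverse c \<in> scalars" "inv\<^bsub>Q\<^esub> (mat c) = mat (inverse c)"
proof -
  have c: "mat c \<in> H" "mat c \<in> carrier Q" using assms H_subset_G by (auto simp: scalars_def)
  have "inv\<^bsub>Q\<^esub> (mat c) \<in> H" by (rule subgroup.m_inv_closed[OF subgroup_H c(1)])
  then obtain d where d: "inv\<^bsub>Q\<^esub> (mat c) = mat d" "d \<in> scalars" by (subst (asm) H_eq) auto
  have "(mat d :: complex^'d^'d) ** mat c = mat 1"
    using group.l_inv[OF group_Q c(2)] by (simp add: d)
  then have "d * c = 1" by (simp add: mat_mult_mat mat_eq_iff)
  moreover from this show "c \<noteq> 0" by auto
  ultimately have "d = inverse c" by (simp add: field_simps)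
  with d show "inverse c \<in> scalars" "inv\<^bsub>Q\<^esub> (mat c) = mat (inverse c)" by simp_all
qed

lemma inv_mat_mult:
  assumes "c \<in> scalars" "A \<in> G"
  shows "inv\<^bsub>Q\<^esub> (mat c ** A) = mat (inverse c) ** inv\<^bsub>Q\<^esub> A"
proof -
  have "mat c \<in> carrier Q" using assms H_subset_G by (auto simp: scalars_def)
  then have "inv\<^bsub>Q\<^esub> (mat c ** A) = inv\<^bsub>Q\<^esub> A ** inv\<^bsub>Q\<^esub> (mat c)"
    using group.inv_mult_group[OF group_Q, of "mat c" A] assms(2) by simp
  then show ?thesis by (simp add: inverse_scalars[OF assms(1)] mat_mult_commute)
qed

text \<open>Multiplication by \<open>c\<close> permutes the scalars, hence leaves their product unchanged.\<close>

lemma scalars_power_card: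
  assumes "c \<in> scalars"
  shows "c ^ card H = 1"
proof -
  have inj: "inj_on ((*) c) scalars" using inverse_scalars[OF assms] by (auto simp: inj_on_def)
  have "(*) c ` scalars = scalars"
    using finite_scalars inj mult_scalars[OF assms] by (intro endo_inj_surj) auto
  then have "\<Prod>scalars = (\<Prod>x\<in>scalars. c * x)"
    using prod.reindex[OF inj, of "\<lambda>x. x"] by simp
  also have "\<dots> = c ^ card H * \<Prod>scalars" by (simp add: prod.distrib card_scalars)
  finally show ?thesis using finite_scalars inverse_scalars(1) by (auto simp: prod_zero_iff)
qed

lemma scalars_powi_eq_1:
  assumes "c \<in> scalars" "int (card H) dvd k"
  shows "c powi k = 1"
  using assms by (auto simp: dvd_def power_int_mult scalars_power_card)

text \<open>This is where it matters that \<open>H\<close> has as many elements as the modulus of the exponents: if \<open>r\<close> is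
  the nonzero residue of \<open>k\<close>, at most \<open>r < |H|\<close> scalars satisfy \<open>c\<^sup>r = 1\<close>.\<close>

lemma scalars_separate:
  assumes "\<not> int (card H) dvd k"
  obtains c where "c \<in> scalars" "c powi k \<noteq> 1"
proof -
  define r where "r = nat (k mod int (card H))"
  have "card H > 0"
    using finite_H subgroup.one_closed[OF subgroup_H] by (auto simp: card_gt_0_iff)
  then have r: "int r = k mod int (card H)" "r < card H" by (auto simp: r_def nat_less_iff)
  then have "r > 0" using assms by (auto simp: dvd_eq_mod_eq_0 intro: gr0I)
  have powi: "c powi k = c ^ r" if "c \<in> scalars" for c
  proof -
    have "k = int (card H) * (k div int (card H)) + int r" by (simp add: r)
    then have "c powi k = c powi (int (card H) * (k div int (card H))) * c powi int r"
      using power_int_add[of c] inverse_scalars(1)[OF that] by metis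
    then show ?thesis using scalars_powi_eq_1[OF that] by simp
  qed
  have "\<not> scalars \<subseteq> {z. z ^ r = 1}"
  proof
    assume "scalars \<subseteq> {z. z ^ r = 1}"
    then have "card H \<le> card {z :: complex. z ^ r = 1}"
      using \<open>r > 0\<close> unfolding card_scalars[symmetric] by (intro card_mono finite_roots_unity) auto
    then show False using r(2) card_roots_unity_eq[OF \<open>r > 0\<close>] by simp
  qed
  then show thesis using that powi by auto
qed

lemma normal_H: "H \<lhd> Q"
proof (rule group.normalI[OF group_Q subgroup_H], intro ballI)
  fix A assume "A \<in> carrier Q"
  have "h ** A = A ** h" if "h \<in> H" for h
    using scalar_H[OF that] by (auto simp: mat_mult_commute)
  then show "H #>\<^bsub>Q\<^esub> A = A <#\<^bsub>Q\<^esub> H" by (simp add: r_coset_def l_coset_def)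
qed

text \<open>Every generator of the coordinate ring of \<open>G\<close> is an eigenfunction of the scalars.\<close>

lemma translate_regular:
  assumes "c \<in> scalars" "p \<in> regular Q"
  shows "(\<lambda>A\<in>G. p (mat c ** A)) \<in> regular Q"
proof -
  let ?S = "{\<lambda>A. A $ i $ j | i j. True} \<union> {\<lambda>A. inverse (det A)} :: (complex^'d^'d \<Rightarrow> complex) set"
  have regular: "regular Q = function_algebra G ?S" by (simp add: matrix_group_def)
  show ?thesis unfolding regular
  proof (rule function_algebra_pullback[OF assms(2)[unfolded regular]])
    show "mat c ** A \<in> G" if "A \<in> G" for A by (rule mat_mult_G[OF assms(1) that])
    fix f assume f: "f \<in> ?S"
    have "\<exists>d. \<forall>A. f (mat c ** A) = d * f A"
    proof (cases "f = (\<lambda>A. inverse (det A))")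
      case True
      then show ?thesis by (auto simp: det_mul)
    next
      case False
      with f obtain i j where "f = (\<lambda>A. A $ i $ j)" by auto
      then show ?thesis by (auto simp: mat_mult_entry)
    qed
    then obtain d where d: "\<And>A. f (mat c ** A) = d * f A" by blast
    from function_algebra.mult[OF function_algebra.const function_algebra.gen[OF f]]
    show "(\<lambda>A\<in>G. f (mat c ** A)) \<in> function_algebra G ?S"
      by (rule function_algebra_cong[where g = "\<lambda>A\<in>G. (\<lambda>A\<in>G. d) A * restrict f G A"]) (simp add: d)
  qed
qed

sublocale finite_quotient H Q "{\<lambda>A. A $ i $ j | i j. True} \<union> {\<lambda>A. inverse (det A)}"
proof (intro finite_quotient.intro finite_quotient_axioms.intro)
  show "H \<lhd> Q" by (rule normal_H)
  show "finite H" by (rule finite_H)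
  show "regular Q = function_algebra (carrier Q) ({\<lambda>A. A $ i $ j | i j. True} \<union> {\<lambda>A. inverse (det A)})"
    by (simp add: matrix_group_def)
  show "(\<lambda>a\<in>carrier Q. p (h \<otimes>\<^bsub>Q\<^esub> a)) \<in> regular Q" if "h \<in> H" "p \<in> regular Q" for h p
  proof -
    obtain c where "h = mat c" "c \<in> scalars" using \<open>h \<in> H\<close> by (subst (asm) H_eq) auto
    then show ?thesis using translate_regular[OF _ that(2)] by simp
  qed
qed

definition scaling :: "('n \<Rightarrow> complex) \<Rightarrow> ('n \<Rightarrow> complex^'d^'d) \<Rightarrow> 'n \<Rightarrow> complex^'d^'d" where
  "scaling c \<rho> = (\<lambda>i. mat (c i) ** \<rho> i)"

lemma scaling_in_rep_space:
  "(\<And>i. c i \<in> scalars) \<Longrightarrow> \<rho> \<in> rep_space Q \<Longrightarrow> scaling c \<rho> \<in> rep_space Q"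
  by (simp add: rep_space_def scaling_def mat_mult_G)

lemma proj_scaling:
  assumes c: "\<And>i. c i \<in> scalars" and \<rho>: "\<rho> \<in> rep_space Q"
  shows "proj (scaling c \<rho>) = proj \<rho>"
proof -
  have "H #>\<^bsub>Q\<^esub> (mat (c i) ** \<rho> i) = H #>\<^bsub>Q\<^esub> \<rho> i" for i
  proof (rule coset_eqI)
    show "\<rho> i \<in> carrier Q" using \<rho> by (simp add: rep_space_def)
    show "mat (c i) ** \<rho> i \<in> H #>\<^bsub>Q\<^esub> \<rho> i" using c[of i] by (auto simp: r_coset_def scalars_def)
  qed
  then show ?thesis by (simp add: proj_def scaling_def)
qed

lemma proj_eq_imp_scaling:
  assumes "\<rho> \<in> rep_space Q" "\<tau> \<in> rep_space Q" "proj \<tau> = proj \<rho>"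
  shows "\<exists>c. (\<forall>i. c i \<in> scalars) \<and> \<tau> = scaling c \<rho>"
proof -
  have "\<forall>i. \<exists>c. c \<in> scalars \<and> \<tau> i = mat c ** \<rho> i"
  proof
    fix i
    have "\<tau> i \<in> H #>\<^bsub>Q\<^esub> \<tau> i" using assms(2) by (intro rcos_self subgroup_axioms) (simp add: rep_space_def)
    also have "H #>\<^bsub>Q\<^esub> \<tau> i = H #>\<^bsub>Q\<^esub> \<rho> i" using fun_cong[OF assms(3), of i] by (simp add: proj_def)
    finally show "\<exists>c. c \<in> scalars \<and> \<tau> i = mat c ** \<rho> i" 
      by (auto simp: r_coset_def scalars_def dest: scalar_H)
  qed
  from choice[OF this] show ?thesis by (auto simp: scaling_def fun_eq_iff)
qed

lemma eval_rep_scaling: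
  fixes \<rho> :: "'n::finite \<Rightarrow> complex^'d^'d"
  assumes c: "\<And>i. c i \<in> scalars" and \<rho>: "\<rho> \<in> rep_space Q"
  shows "eval_rep Q (scaling c \<rho>) g = mat (word_weight c g) ** eval_rep Q \<rho> g"
proof (induction g)
  case Nil
  show ?case by (simp add: eval_rep_def word_weight_Nil mat_mult_mat)
next
  case (Cons x g)
  obtain j b where x: "x = (j, b)" by (cases x)
  define A where "A = (if b then \<rho> j else inv\<^bsub>Q\<^esub> (\<rho> j))"
  define a where "a = (if b then c j else inverse (c j))"
  have nonzero: "c i \<noteq> 0" for i by (rule inverse_scalars(1)[OF c])
  have "\<rho> j \<in> G" using \<rho> by (simp add: rep_space_def)
  then have "(if b then scaling c \<rho> j else inv\<^bsub>Q\<^esub> (scaling c \<rho> j)) = mat a ** A"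
    by (simp add: scaling_def a_def A_def inv_mat_mult[OF c])
  then have "eval_rep Q (scaling c \<rho>) (x # g) = (mat a ** A) ** eval_rep Q (scaling c \<rho>) g"
    by (simp add: eval_rep_def x)
  also have "\<dots> = mat a ** (A ** mat (word_weight c g)) ** eval_rep Q \<rho> g"
    by (simp add: Cons.IH matrix_mul_assoc)
  also have "\<dots> = mat (a * word_weight c g) ** (A ** eval_rep Q \<rho> g)"
    by (simp add: mat_mult_commute[of A] matrix_mul_assoc mat_mult_mat)
  also have "A ** eval_rep Q \<rho> g = eval_rep Q \<rho> (x # g)"
    by (simp add: eval_rep_def x A_def)
  also have "a * word_weight c g = word_weight c (x # g)"
    by (simp add: x a_def word_weight_Cons nonzero)
  finally show ?case .
qed

definition trace_product :: "'n word list \<Rightarrow> ('n \<Rightarrow> complex^'d^'d) \<Rightarrow> complex" where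
  "trace_product gs \<rho> = (\<Prod>g\<leftarrow>gs. trace (eval_rep Q \<rho> g))"

lemma trace_product_scaling:
  fixes \<rho> :: "'n::finite \<Rightarrow> complex^'d^'d"
  assumes c: "\<And>i. c i \<in> scalars" and \<rho>: "\<rho> \<in> rep_space Q"
  shows "trace_product gs (scaling c \<rho>)
    = (\<Prod>i\<in>UNIV. c i powi (\<Sum>g\<leftarrow>gs. exponent_sum g i)) * trace_product gs \<rho>"
proof -
  have "trace_product gs (scaling c \<rho>) = (\<Prod>g\<leftarrow>gs. word_weight c g) * trace_product gs \<rho>"
    by (induction gs) (simp_all add: trace_product_def eval_rep_scaling[OF c \<rho>] trace_mat_mult)
  then show ?thesis by (simp add: prod_word_weight inverse_scalars(1)[OF c])
qed

lemma trace_product_rep_class: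
  "\<rho> \<in> rep_space Q \<Longrightarrow> (\<Prod>g\<leftarrow>gs. trace_function G g (rep_class Q \<rho>)) = trace_product gs \<rho>"
  by (simp add: trace_product_def trace_function_rep_class[OF subgroup_G])

lemma trace_function_coordinate_ring: "trace_function G g \<in> coordinate_ring Q"
proof -
  have "(\<lambda>\<rho>\<in>rep_space Q. trace_function G g (rep_class Q \<rho>))
      = (\<lambda>\<rho>\<in>rep_space Q. trace (eval_rep Q \<rho> g))"
    by (rule restrict_ext) (rule trace_function_rep_class[OF subgroup_G])
  moreover have "trace_function G g \<in> extensional (char_variety Q)"
    unfolding trace_function_def by (rule restrict_extensional)
  ultimately show ?thesis
    using trace_invariant[OF subgroup_G, of g] unfolding coordinate_ring_def by simp
qed

text \<open>The product of traces has trivial character under \<open>H\<^sup>N\<close>, hence is constant on the fibres.\<close>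

lemma trace_descent_ex1:
  fixes gs :: "'n::finite word list"
  assumes weight: "\<And>i. int (card H) dvd (\<Sum>g\<leftarrow>gs. exponent_sum g i)"
  shows "\<exists>!l. is_trace_descent G H gs l"
proof -
  define F :: "('n \<Rightarrow> complex^'d^'d) set \<Rightarrow> complex" where
    "F = (\<lambda>x\<in>char_variety Q. \<Prod>g\<leftarrow>gs. trace_function G g x)"
  have "(\<lambda>x\<in>char_variety Q. \<Prod>f\<leftarrow>map (trace_function G) gs. f x)
      \<in> function_algebra (char_variety Q) (range (trace_function G :: 'n word \<Rightarrow> _))"
    by (rule function_algebra_prod_list) auto
  then have "F \<in> function_algebra (char_variety Q) (range (trace_function G))"
    by (simp add: F_def comp_def)
  then have F: "F \<in> coordinate_ring Q"
    using coordinate_ring_closed[OF group_Q, of "range (trace_function G)"]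
      trace_function_coordinate_ring by blast
  have F_class: "F (rep_class Q \<rho>) = trace_product gs \<rho>" if "\<rho> \<in> rep_space Q" for \<rho>
    using that by (simp add: F_def rep_class_in_char_variety trace_product_rep_class)
  have fibre_const: "F (rep_class Q \<tau>) = F (rep_class Q \<rho>)"
    if \<rho>: "\<rho> \<in> rep_space Q" and \<tau>: "\<tau> \<in> rep_space Q" and eq: "proj \<tau> = proj \<rho>" for \<rho> \<tau>
  proof -
    obtain c where c: "\<And>i. c i \<in> scalars" "\<tau> = scaling c \<rho>"
      using proj_eq_imp_scaling[OF \<rho> \<tau> eq] by blast
    show ?thesis
      unfolding F_class[OF \<rho>] F_class[OF \<tau>] unfolding c(2) trace_product_scaling[OF c(1) \<rho>]
      by (simp add: scalars_powi_eq_1[OF c(1) weight])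
  qed
  have descent_iff: "is_trace_descent G H gs l \<longleftrightarrow>
      l \<in> coordinate_ring QH \<and> (\<forall>x\<in>char_variety Q. F x = l (induced_map Q H x))" for l
  proof -
    have "(\<forall>x\<in>char_variety Q. (\<Prod>g\<leftarrow>gs. trace_function G g x) = l (induced_map Q H x)) \<longleftrightarrow>
        (\<forall>x\<in>char_variety Q. F x = l (induced_map Q H x))"
      by (rule ball_cong[OF refl]) (simp only: F_def restrict_apply')
    then show ?thesis by (simp only: is_trace_descent_def)
  qed
  have "\<exists>!l. l \<in> coordinate_ring QH \<and> (\<forall>x\<in>char_variety Q. F x = l (induced_map Q H x))"
    by (rule coordinate_ring_descend[OF F]) (rule fibre_const)
  then show ?thesis unfolding descent_iff .
qed

text \<open>Scaling the \<open>i\<close>-th coordinate by a suitable scalar permutes the fibre and multiplies the sum by a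
  factor different from \<open>1\<close>.\<close>

lemma trace_product_fibre_sum:
  fixes gs :: "'n::finite word list"
  assumes weight: "\<not> int (card H) dvd (\<Sum>g\<leftarrow>gs. exponent_sum g i)" and \<sigma>: "\<sigma> \<in> rep_space QH"
  shows "(\<Sum>\<rho>\<in>fibre \<sigma>. trace_product gs \<rho>) = 0"
proof -
  obtain a where a: "a \<in> scalars" "a powi (\<Sum>g\<leftarrow>gs. exponent_sum g i) \<noteq> 1"
    by (rule scalars_separate[OF weight])
  define c where "c = (\<lambda>j. if j = i then a else 1)"
  define d where "d = (\<lambda>j. inverse (c j))"
  have c: "c j \<in> scalars" for j by (simp add: c_def a one_scalars)
  have d: "d j \<in> scalars" for j by (simp add: d_def inverse_scalars(2)[OF c])
  obtain \<rho>0 where \<rho>0: "\<rho>0 \<in> rep_space Q" "\<sigma> = proj \<rho>0" by (rule rep_space_quotientE[OF \<sigma>])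
  have closed: "scaling e \<rho> \<in> fibre \<sigma>" if "\<And>j. e j \<in> scalars" "\<rho> \<in> fibre \<sigma>" for e \<rho>
    using that by (simp add: \<rho>0 fibre_proj scaling_in_rep_space proj_scaling)
  have "scaling d (scaling c \<rho>) = \<rho>" "scaling c (scaling d \<rho>) = \<rho>" for \<rho>
    using inverse_scalars(1)[OF c]
    by (simp_all add: scaling_def d_def matrix_mul_assoc mat_mult_mat)
  then have "(\<Sum>\<rho>\<in>fibre \<sigma>. trace_product gs \<rho>) = (\<Sum>\<rho>\<in>fibre \<sigma>. trace_product gs (scaling c \<rho>))"
    by (intro sum.reindex_bij_witness[of _ "scaling c" "scaling d"]) (simp_all add: closed c d)
  also have "\<dots> = (\<Sum>\<rho>\<in>fibre \<sigma>. a powi (\<Sum>g\<leftarrow>gs. exponent_sum g i) * trace_product gs \<rho>)"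
  proof (rule sum.cong[OF refl])
    fix \<rho> assume "\<rho> \<in> fibre \<sigma>"
    then have \<rho>: "\<rho> \<in> rep_space Q" by (rule fibre_in_rep_space[OF \<sigma>])
    have "(\<Prod>j\<in>UNIV. c j powi (\<Sum>g\<leftarrow>gs. exponent_sum g j))
        = (\<Prod>j\<in>UNIV. if j = i then a powi (\<Sum>g\<leftarrow>gs. exponent_sum g i) else 1)"
      by (rule prod.cong) (simp_all add: c_def)
    then show "trace_product gs (scaling c \<rho>)
        = a powi (\<Sum>g\<leftarrow>gs. exponent_sum g i) * trace_product gs \<rho>"
      by (simp add: trace_product_scaling[OF c \<rho>])
  qed
  finally show ?thesis using a(2) by (simp flip: sum_distrib_left)
qed

lemma trace_descents_generate:
  fixes B :: "'n::finite word set"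
  assumes B: "function_algebra (char_variety Q) (trace_function G ` B) = coordinate_ring Q"
  shows "function_algebra (char_variety QH)
      {trace_descent G H gs | gs. gs \<noteq> [] \<and> set gs \<subseteq> B \<and>
        (\<forall>i. int (card H) dvd (\<Sum>g\<leftarrow>gs. exponent_sum g i))} = coordinate_ring QH"
    (is "function_algebra _ ?M = _")
proof (rule coordinate_ring_quotient_generated)
  show "coordinate_ring Q \<subseteq> function_algebra (char_variety Q) (trace_function G ` B)"
    unfolding B by (rule order_refl)
  have descent: "is_trace_descent G H gs (trace_descent G H gs)"
    if "\<forall>i. int (card H) dvd (\<Sum>g\<leftarrow>gs. exponent_sum g i)" for gs :: "'n word list"
  proof -
    have "\<exists>!l. is_trace_descent G H gs l" by (rule trace_descent_ex1) (rule spec[OF that])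
    from theI'[OF this] show ?thesis unfolding trace_descent_def .
  qed
  then show "?M \<subseteq> coordinate_ring QH" by (auto simp: is_trace_descent_def)
  fix fs :: "(('n \<Rightarrow> complex^'d^'d) set \<Rightarrow> complex) list"
  assume "set fs \<subseteq> trace_function G ` B" "fs \<noteq> []"
  then have "fs \<in> map (trace_function G) ` lists B"
    by (simp add: lists_image[symmetric] in_lists_conv_set subset_iff)
  with \<open>fs \<noteq> []\<close> obtain gs where gs: "fs = map (trace_function G) gs" "set gs \<subseteq> B" "gs \<noteq> []"
    by auto
  have prod: "(\<Prod>f\<leftarrow>fs. f (rep_class Q \<rho>)) = trace_product gs \<rho>" if "\<rho> \<in> rep_space Q" for \<rho>
    using trace_product_rep_class[OF that] by (simp add: gs comp_def)
  show "(\<exists>l\<in>?M. \<forall>\<rho>\<in>rep_space Q. (\<Prod>f\<leftarrow>fs. f (rep_class Q \<rho>)) = l (rep_class QH (proj \<rho>))) \<or>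
      (\<forall>\<sigma>\<in>rep_space QH. (\<Sum>\<rho>\<in>fibre \<sigma>. \<Prod>f\<leftarrow>fs. f (rep_class Q \<rho>)) = 0)"
  proof (cases "\<forall>i. int (card H) dvd (\<Sum>g\<leftarrow>gs. exponent_sum g i)")
    case True
    have "(\<Prod>f\<leftarrow>fs. f (rep_class Q \<rho>)) = trace_descent G H gs (rep_class QH (proj \<rho>))"
      if \<rho>: "\<rho> \<in> rep_space Q" for \<rho>
    proof -
      have "(\<Prod>g\<leftarrow>gs. trace_function G g (rep_class Q \<rho>))
          = trace_descent G H gs (induced_map Q H (rep_class Q \<rho>))"
        using descent[OF True] rep_class_in_char_variety[OF \<rho>] by (simp add: is_trace_descent_def)
      then show ?thesis by (simp only: prod[OF \<rho>] trace_product_rep_class[OF \<rho>] induced_map_proj[OF \<rho>])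
    qed
    moreover have "trace_descent G H gs \<in> ?M" using True gs(2,3) by blast
    ultimately show ?thesis by blast
  next
    case False
    then obtain i where i: "\<not> int (card H) dvd (\<Sum>g\<leftarrow>gs. exponent_sum g i)" by blast
    have "(\<Sum>\<rho>\<in>fibre \<sigma>. \<Prod>f\<leftarrow>fs. f (rep_class Q \<rho>)) = 0" if \<sigma>: "\<sigma> \<in> rep_space QH" for \<sigma>
    proof -
      have "(\<Sum>\<rho>\<in>fibre \<sigma>. \<Prod>f\<leftarrow>fs. f (rep_class Q \<rho>)) = (\<Sum>\<rho>\<in>fibre \<sigma>. trace_product gs \<rho>)"
        by (rule sum.cong) (simp_all add: prod fibre_in_rep_space[OF \<sigma>])
      then show ?thesis by (simp only: trace_product_fibre_sum[OF i \<sigma>])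
    qed
    then show ?thesis by blast
  qed
qed

end

theorem theorem7:
  fixes G H :: "(complex^'d^'d) set" and m :: nat
  assumes "reductive G"
    and "subgroup H (matrix_group G)"
    and "cyclic_group ((matrix_group G)\<lparr>carrier := H\<rparr>)"
    and "m > 0" and "card H = m"
    and "\<forall>A\<in>H. \<exists>c. A = mat c"
  shows "(\<forall>gs :: ('n::finite) word list.
            set gs \<subseteq> carrier free_group \<and>
            (\<forall>i. (\<Sum>g\<leftarrow>gs. exponent_vector m g i) mod int m = 0) \<longrightarrow>
            (\<exists>!l. is_trace_descent G H gs l)) \<and>
         (\<forall>B :: 'n word set.
            B \<subseteq> carrier free_group \<and>
            function_algebra (char_variety (matrix_group G)) (trace_function G ` B)
              = coordinate_ring (matrix_group G) \<longrightarrow>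
            function_algebra (char_variety (quotient_group (matrix_group G) H))
              {trace_descent G H gs | gs. gs \<noteq> [] \<and> set gs \<subseteq> B \<and>
                 (\<forall>i. (\<Sum>g\<leftarrow>gs. exponent_vector m g i) mod int m = 0)}
              = coordinate_ring (quotient_group (matrix_group G) H))"
proof -
  have "card H > 0" using assms(4,5) by simp
  then have "finite H" by (rule card_ge_0_finite)
  interpret scalar_subgroup G H
    using assms(1,2,6) \<open>finite H\<close>
    by (intro scalar_subgroup.intro) (auto simp: reductive_def algebraic_matrix_group_def)
  have weight: "(\<Sum>g\<leftarrow>gs. exponent_vector m g i) mod int m = 0 \<longleftrightarrow>
      int (card H) dvd (\<Sum>g\<leftarrow>gs. exponent_sum g i)" for gs :: "'n word list" and i
    unfolding sum_exponent_vector_mod assms(5) by (simp only: dvd_eq_mod_eq_0)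
  show ?thesis
    unfolding weight using trace_descent_ex1 trace_descents_generate by blast
qed

end
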